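(* Let $(\mathcal A,\varphi,\psi,\theta)$ be a unital 3-algebraic probability space, $a\in\mathcal A$, let $(\lambda,\mu,\nu)$ be the distribution of $a$, let $\{(\lambda_t,\mu_t,\nu_t)\}_{t\in\mathbb R}$ be the one-parameter $\alpha$-free convolution group associated with $(\lambda,\mu,\nu)$, and let $B_\mu(z)=\frac{\partial}{\partial t}\big|_{t=0}F_{\mu_t}(z)$, $C_\nu(z)=\frac{\partial}{\partial t}\big|_{t=0}F_{\nu_t}(z)$. Then the following differential equations hold (as identities of formal Laurent series): $$\frac{\partial F_{\mu_t}}{\partial t}=(B_\mu\circ F_{\nu_t})\cdot\frac{\partial F_{\mu_t}}{\partial z},\qquad \frac{\partial F_{\nu_t}}{\partial t}=(C_\nu\circ F_{\mu_t})\cdot\frac{\partial F_{\nu_t}}{\partial z},$$ $$\frac{\partial F_{\mu_t}}{\partial t}=B_\mu\circ F_{\mu_t}+(C_\nu\circ F_{\mu_t})\cdot\Big[\frac{\partial F_{\mu_t}}{\partial z}-1\Big],\qquad \frac{\partial F_{\nu_t}}{\partial t}=C_\nu\circ F_{\nu_t}+(B_\mu\circ F_{\nu_t})\cdot\Big[\frac{\partial F_{\nu_t}}{\partial z}-1\Big],$$ $$\frac{\partial F_{\mu_t}}{\partial t}=\frac{(B_\mu\circ F_{\nu_t})(B_\mu\circ F_{\mu_t}-C_\nu\circ F_{\mu_t})}{B_\mu\circ F_{\nu_t}-C_\nu\circ F_{\mu_t}},\qquad \frac{\partial F_{\nu_t}}{\partial t}=\frac{(C_\nu\circ F_{\mu_t})(B_\mu\circ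 F_{\nu_t}-C_\nu\circ F_{\nu_t})}{B_\mu\circ F_{\nu_t}-C_\nu\circ F_{\mu_t}},$$ where the last two equations are asserted only when the denominator is nonzero.
   Context: Algebras are over $\mathbb C$. A unital 3-algebraic probability space is a unital algebra with three unital linear functionals. A distribution is a unital linear functional on $\mathbb C[x]$. The distribution of $a$ is the triplet $(\lambda,\mu,\nu)$ with $\lambda(x^n)=\varphi(a^n)$, $\mu(x^n)=\psi(a^n)$, $\nu(x^n)=\theta(a^n)$. For a distribution $\mu$, $G_\mu(z)=\sum_{n\ge0}\mu(x^n)z^{-n-1}$ and $F_\mu(z)=1/G_\mu(z)=z-b_1-b_2z^{-1}-\cdots$, as formal Laurent series (in $z^{-1}$). Derivatives in $t$ are taken coefficientwise; composition $f\circ F$ of a series $f(z)=\sum_{n\ge0}c_nz^{-n}$ with $F(z)=z+O(1)$ is formal. **$\alpha$-free product.** For a totally ordered set $I$, $I^\ast$ is the set of finite sequences $\mathbf i=(i_1,\dots,i_n)$, $n\ge1$, in $I$ with $i_k\ne i_{k+1}$. $\mathrm{Peak}(\mathbf i)=\{k\in\{2,\dots,n-1\}: i_{k-1}<i_k>i_{k+1}\}$, $\mathrm{Bot}(\mathbf i)=\{k\in\{2,\dots,n-1\}: i_{k-1}>i_k<i_{k+1}\}$. Given unital 3-algebraic probability spaces $(\mathcal A_i,\varphi_i,\psi_i,\theta_i)$, define linear functionals on $\mathcal A_{i_k}$: $\alpha_{\mathbf i,1}=\varphi_{i_1}$, $\alpha_{\mathbf i,k}=\psi_{i_k}$ if $k\in\mathrm{Peak}(\mathbf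 i)$, $\theta_{i_k}$ if $k\in\mathrm{Bot}(\mathbf i)$, $0$ otherwise; $\beta_{\mathbf i,k}$ (resp. $\gamma_{\mathbf i,k}$) is the same with $\varphi_{i_1}$ replaced by $\psi_{i_1}$ (resp. $\theta_{i_1}$). The $\alpha$-free product is the unital free product $\mathcal U=\ast_{i\in I}\mathcal A_i$ with the unique unital linear functionals $\widetilde\varphi,\widetilde\psi,\widetilde\theta$ such that for every $\mathbf i\in I^\ast$, $a_k\in\mathcal A_{i_k}$: $\widetilde\varphi(a_1\cdots a_n)=0$ if all $a_k\in\ker\alpha_{\mathbf i,k}$; $\widetilde\psi(a_1\cdots a_n)=0$ if all $a_k\in\ker\beta_{\mathbf i,k}$; $\widetilde\theta(a_1\cdots a_n)=0$ if all $a_k\in\ker\gamma_{\mathbf i,k}$. **One-parameter group.** Take the $\alpha$-free product $(\mathcal U,\widetilde\varphi,\widetilde\psi,\widetilde\theta)$ over $\mathbb N=\{1,2,\dots\}$ of copies of $(\mathcal A,\varphi,\psi,\theta)$, let $a^{(j)}$ be the $j$-th copy of $a$, $N.a=a^{(1)}+\cdots+a^{(N)}$ and $0.a=0$. For $N\in\{0\}\cup\mathbb N$ let $\lambda_N(x^n)=\widetilde\varphi((N.a)^n)$, $\mu_N(x^n)=\widetilde\psi((N.a)^n)$, $\nu_N(x^n)=\widetilde\theta((N.a)^n)$. For $n\ge1$ these are polynomials in $N$ without constant term; replacing $N$ by a real number $t$ in these polynomials defines distributions $\lambda_t,\mu_t,\nu_t$ for $t\in\mathbb R$. *)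

theory Defs
  imports
    "HOL-Analysis.Analysis"
    "HOL-Library.Poly_Mapping"
    "HOL-Computational_Algebra.Formal_Laurent_Series"
begin

section \<open>Unital complex algebras and unital linear functionals\<close>

text \<open>
  The zero algebra is not excluded by the class; it carries no unital linear functional.
\<close>

class complex_algebra_1 = ring + monoid_mult +
  fixes scaleC :: "complex \<Rightarrow> 'a \<Rightarrow> 'a"  (infixr "*\<^sub>C" 75)
  assumes scaleC_add_right: "c *\<^sub>C (x + y) = c *\<^sub>C x + c *\<^sub>C y"
    and scaleC_add_left: "(c + d) *\<^sub>C x = c *\<^sub>C x + d *\<^sub>C x"
    and scaleC_scaleC: "c *\<^sub>C d *\<^sub>C x = (c * d) *\<^sub>C x"
    and scaleC_one: "1 *\<^sub>C x = x"
    and mult_scaleC_left: "(c *\<^sub>C x) * y = c *\<^sub>C (x * y)"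
    and mult_scaleC_right: "x * (c *\<^sub>C y) = c *\<^sub>C (x * y)"

definition unital_linear :: "('a::complex_algebra_1 \<Rightarrow> complex) \<Rightarrow> bool" where
  "unital_linear f \<longleftrightarrow> Vector_Spaces.linear scaleC (*) f \<and> f 1 = 1"

section \<open>The unital free product of copies of an algebra\<close>

text \<open>
  The free product of copies of \<open>'a\<close> indexed by \<open>'i\<close> is the free unital algebra on the
  letters \<open>(i, x)\<close> modulo the two-sided ideal that makes each map sending \<open>x\<close> to the letter
  \<open>(i, x)\<close> a unital algebra homomorphism. The free unital algebra is the monoid algebra of
  words; words are written additively because \<open>Poly_Mapping\<close> takes its convolution product
  over an additive monoid.
\<close>

datatype 'a word = Word (letters: "'a list")

instantiation word :: (type) monoid_add
begin
definition zero_word :: "'a word" where "0 = Word []"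
definition plus_word :: "'a word \<Rightarrow> 'a word \<Rightarrow> 'a word" where
  "v + w = Word (letters v @ letters w)"
instance by standard (auto simp: zero_word_def plus_word_def)
end

type_synonym ('i, 'a) free_algebra = "('i \<times> 'a) word \<Rightarrow>\<^sub>0 complex"

definition letter :: "'i \<Rightarrow> 'a \<Rightarrow> ('i, 'a) free_algebra" where
  "letter i x = Poly_Mapping.single (Word [(i, x)]) 1"

definition const :: "complex \<Rightarrow> ('i, 'a) free_algebra" where
  "const c = Poly_Mapping.single 0 c"

inductive_set free_product_ideal :: "('i, 'a::complex_algebra_1) free_algebra set" where
  letter_add: "letter i (x + y) - (letter i x + letter i y) \<in> free_product_ideal"
| letter_scaleC: "letter i (c *\<^sub>C x) - const c * letter i x \<in> free_product_ideal"
| letter_mult: "letter i (x * y) - letter i x * letter i y \<in> free_product_ideal"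
| letter_one: "letter i 1 - 1 \<in> free_product_ideal"
| zero: "0 \<in> free_product_ideal"
| add: "u \<in> free_product_ideal \<Longrightarrow> v \<in> free_product_ideal \<Longrightarrow> u + v \<in> free_product_ideal"
| mult: "u \<in> free_product_ideal \<Longrightarrow> p * u * q \<in> free_product_ideal"

lemma free_product_ideal_mult_left: "u \<in> free_product_ideal \<Longrightarrow> p * u \<in> free_product_ideal"
  using free_product_ideal.mult[of u p 1] by simp

lemma free_product_ideal_mult_right: "u \<in> free_product_ideal \<Longrightarrow> u * q \<in> free_product_ideal"
  using free_product_ideal.mult[of u 1 q] by simp

lemma free_product_ideal_uminus: "u \<in> free_product_ideal \<Longrightarrow> - u \<in> free_product_ideal"
  using free_product_ideal_mult_left[of u "- 1"] by simp

definition free_product_cong ::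
    "('i, 'a::complex_algebra_1) free_algebra \<Rightarrow> ('i, 'a) free_algebra \<Rightarrow> bool" where
  "free_product_cong u v \<longleftrightarrow> u - v \<in> free_product_ideal"

lemma free_product_cong_equivp:
  "equivp (free_product_cong :: ('i, 'a::complex_algebra_1) free_algebra \<Rightarrow> _)"
proof (rule equivpI)
  show "reflp (free_product_cong :: ('i, 'a) free_algebra \<Rightarrow> _)"
    by (auto simp: reflp_def free_product_cong_def intro: free_product_ideal.zero)
  show "symp (free_product_cong :: ('i, 'a) free_algebra \<Rightarrow> _)"
  proof (rule sympI)
    fix u v :: "('i, 'a) free_algebra"
    assume "free_product_cong u v"
    then show "free_product_cong v u"
      unfolding free_product_cong_def by (drule_tac free_product_ideal_uminus) simp
  qed
  show "transp (free_product_cong :: ('i, 'a) free_algebra \<Rightarrow> _)"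
  proof (rule transpI)
    fix u v w :: "('i, 'a) free_algebra"
    assume "free_product_cong u v" "free_product_cong v w"
    then have "(u - v) + (v - w) \<in> free_product_ideal"
      unfolding free_product_cong_def by (rule free_product_ideal.add)
    then show "free_product_cong u w"
      by (simp add: free_product_cong_def)
  qed
qed

quotient_type (overloaded) ('i, 'a) free_product =
    "('i, 'a::complex_algebra_1) free_algebra" / free_product_cong
  by (rule free_product_cong_equivp)

instantiation free_product :: (type, complex_algebra_1) complex_algebra_1
begin

lift_definition zero_free_product :: "('a, 'b) free_product" is "0 :: ('a, 'b) free_algebra" .

lift_definition one_free_product :: "('a, 'b) free_product" is "1 :: ('a, 'b) free_algebra" .

lift_definition plus_free_product ::
    "('a, 'b) free_product \<Rightarrow> ('a, 'b) free_product \<Rightarrow> ('a, 'b) free_product" is "(+)"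
proof -
  fix u u' v v' :: "('a, 'b) free_algebra"
  assume "free_product_cong u u'" "free_product_cong v v'"
  then have "(u - u') + (v - v') \<in> free_product_ideal"
    unfolding free_product_cong_def by (rule free_product_ideal.add)
  then show "free_product_cong (u + v) (u' + v')"
    by (simp add: free_product_cong_def add_diff_add)
qed

lift_definition uminus_free_product :: "('a, 'b) free_product \<Rightarrow> ('a, 'b) free_product" is uminus
proof -
  fix u u' :: "('a, 'b) free_algebra"
  assume "free_product_cong u u'"
  then have "- (u - u') \<in> free_product_ideal"
    unfolding free_product_cong_def by (rule free_product_ideal_uminus)
  then show "free_product_cong (- u) (- u')"
    by (simp add: free_product_cong_def)
qed

definition minus_free_product ::
    "('a, 'b) free_product \<Rightarrow> ('a, 'b) free_product \<Rightarrow> ('a, 'b) free_product" where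
  "x - y = x + - y" for x y :: "('a, 'b) free_product"

lift_definition times_free_product ::
    "('a, 'b) free_product \<Rightarrow> ('a, 'b) free_product \<Rightarrow> ('a, 'b) free_product" is "(*)"
proof -
  fix u u' v v' :: "('a, 'b) free_algebra"
  assume "free_product_cong u u'" "free_product_cong v v'"
  then have "(u - u') * v + u' * (v - v') \<in> free_product_ideal"
    unfolding free_product_cong_def
    by (intro free_product_ideal.add free_product_ideal_mult_left free_product_ideal_mult_right)
  then show "free_product_cong (u * v) (u' * v')"
    by (simp add: free_product_cong_def left_diff_distrib right_diff_distrib)
qed

lift_definition scaleC_free_product ::
    "complex \<Rightarrow> ('a, 'b) free_product \<Rightarrow> ('a, 'b) free_product" is "\<lambda>c u. const c * u"
  by (simp add: free_product_cong_def free_product_ideal_mult_left flip: right_diff_distrib)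

instance
proof
  have cong: "free_product_cong u v" if "u = v" for u v :: "('a, 'b) free_algebra"
    using that by (simp add: free_product_cong_def free_product_ideal.zero)
  have const_commute: "u * const c = const c * u" for u :: "('a, 'b) free_algebra" and c
  proof (induction u rule: update_induct)
    case const
    then show ?case by simp
  next
    case (update u w b)
    have "Poly_Mapping.update w b u = u + Poly_Mapping.single w b"
      using update(1) by (intro poly_mapping_eqI)
        (auto simp: lookup_update lookup_add lookup_single in_keys_iff when_def)
    then show ?case
      using update(3)
      by (simp add: const_def mult_single mult.commute[of b] distrib_left distrib_right)
  qed
  have const_add: "const (c + d) = const c + (const d :: ('a, 'b) free_algebra)" for c d
    by (simp add: const_def single_add)
  have const_mult: "const (c * d) = const c * (const d :: ('a, 'b) free_algebra)" for c d
    by (simp add: const_def mult_single)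
  have const_one: "const 1 = (1 :: ('a, 'b) free_algebra)"
    by (simp add: const_def)
  fix x y z :: "('a, 'b) free_product" and c d :: complex
  show "x + y + z = x + (y + z)" by transfer (rule cong, simp add: add.assoc)
  show "x + y = y + x" by transfer (rule cong, simp add: add.commute)
  show "0 + x = x" by transfer (rule cong, simp)
  show "- x + x = 0" by transfer (rule cong, simp)
  show "x - y = x + - y" by (rule minus_free_product_def)
  show "x * y * z = x * (y * z)" by transfer (rule cong, simp add: mult.assoc)
  show "(x + y) * z = x * z + y * z" by transfer (rule cong, simp add: distrib_right)
  show "x * (y + z) = x * y + x * z" by transfer (rule cong, simp add: distrib_left)
  show "1 * x = x" by transfer (rule cong, simp)
  show "x * 1 = x" by transfer (rule cong, simp)
  show "c *\<^sub>C (x + y) = c *\<^sub>C x + c *\<^sub>C y"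
    by transfer (rule cong, simp add: distrib_left)
  show "(c + d) *\<^sub>C x = c *\<^sub>C x + d *\<^sub>C x"
    by transfer (rule cong, simp add: const_add distrib_right)
  show "c *\<^sub>C d *\<^sub>C x = (c * d) *\<^sub>C x"
    by transfer (rule cong, simp add: const_mult mult.assoc)
  show "1 *\<^sub>C x = x" by transfer (rule cong, simp add: const_one)
  show "(c *\<^sub>C x) * y = c *\<^sub>C (x * y)" by transfer (rule cong, simp add: mult.assoc)
  show "x * (c *\<^sub>C y) = c *\<^sub>C (x * y)"
    by transfer (rule cong, simp add: const_commute flip: mult.assoc)
qed

end

lift_definition embed :: "'i \<Rightarrow> 'a \<Rightarrow> ('i, 'a::complex_algebra_1) free_product" is letter .

section \<open>The \<open>\<alpha>\<close>-free product\<close>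

text \<open>
  Index sequences are lists, so positions are counted from \<open>0\<close>.
  The factors share the underlying algebra \<open>'a\<close>; their functionals may depend on the index.
\<close>

definition Peak :: "'i::linorder list \<Rightarrow> nat set" where
  "Peak is = {k. 0 < k \<and> k + 1 < length is \<and> is ! (k - 1) < is ! k \<and> is ! k > is ! (k + 1)}"

definition Bot :: "'i::linorder list \<Rightarrow> nat set" where
  "Bot is = {k. 0 < k \<and> k + 1 < length is \<and> is ! (k - 1) > is ! k \<and> is ! k < is ! (k + 1)}"

text \<open>
  With \<open>\<omega> = \<phi>, \<psi>, \<theta>\<close> this is the functional \<open>\<alpha>\<close>, \<open>\<beta>\<close>, \<open>\<gamma>\<close>, respectively, at position \<open>k\<close> of
  the index sequence.
\<close>

definition position_functional ::
    "('i \<Rightarrow> 'a \<Rightarrow> complex) \<Rightarrow> ('i \<Rightarrow> 'a \<Rightarrow> complex) \<Rightarrow> ('i \<Rightarrow> 'a \<Rightarrow> complex)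
      \<Rightarrow> 'i::linorder list \<Rightarrow> nat \<Rightarrow> 'a \<Rightarrow> complex" where
  "position_functional \<omega> \<psi> \<theta> is k =
     (if k = 0 then \<omega> (is ! 0)
      else if k \<in> Peak is then \<psi> (is ! k)
      else if k \<in> Bot is then \<theta> (is ! k)
      else (\<lambda>_. 0))"

definition vanishes_on_centred ::
    "('i \<Rightarrow> 'a::complex_algebra_1 \<Rightarrow> complex) \<Rightarrow> ('i \<Rightarrow> 'a \<Rightarrow> complex) \<Rightarrow> ('i \<Rightarrow> 'a \<Rightarrow> complex)
      \<Rightarrow> (('i::linorder, 'a) free_product \<Rightarrow> complex) \<Rightarrow> bool" where
  "vanishes_on_centred \<omega> \<psi> \<theta> F \<longleftrightarrow>
     (\<forall>is as. is \<noteq> [] \<and> distinct_adj is \<and> length as = length is \<and>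
        (\<forall>k < length is. position_functional \<omega> \<psi> \<theta> is k (as ! k) = 0) \<longrightarrow>
        F (prod_list (map2 embed is as)) = 0)"

definition alpha_free_product ::
    "('i \<Rightarrow> 'a::complex_algebra_1 \<Rightarrow> complex) \<Rightarrow> ('i \<Rightarrow> 'a \<Rightarrow> complex) \<Rightarrow> ('i \<Rightarrow> 'a \<Rightarrow> complex)
      \<Rightarrow> (('i::linorder, 'a) free_product \<Rightarrow> complex)
      \<Rightarrow> (('i, 'a) free_product \<Rightarrow> complex)
      \<Rightarrow> (('i, 'a) free_product \<Rightarrow> complex) \<Rightarrow> bool" where
  "alpha_free_product \<phi> \<psi> \<theta> \<Phi> \<Psi> \<Theta> \<longleftrightarrow>
     unital_linear \<Phi> \<and> unital_linear \<Psi> \<and> unital_linear \<Theta> \<and>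
     vanishes_on_centred \<phi> \<psi> \<theta> \<Phi> \<and>
     vanishes_on_centred \<psi> \<psi> \<theta> \<Psi> \<and>
     vanishes_on_centred \<theta> \<psi> \<theta> \<Theta>"

section \<open>The one-parameter group\<close>

text \<open>
  The ordered index set \<open>{1, 2, \<dots>}\<close> of the copies is relabelled as \<open>{0, 1, \<dots>}\<close>, so that the
  first \<open>N\<close> copies are those with index below \<open>N\<close>.
\<close>

definition dot :: "nat \<Rightarrow> 'a \<Rightarrow> (nat, 'a::complex_algebra_1) free_product" where
  "dot N a = (\<Sum>j<N. embed j a)"

definition distribution_of_moments :: "(nat \<Rightarrow> complex) \<Rightarrow> complex poly \<Rightarrow> complex" where
  "distribution_of_moments m p = (\<Sum>n\<le>degree p. coeff p n * m n)"

definition moment_poly ::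
    "((nat, 'a::complex_algebra_1) free_product \<Rightarrow> complex) \<Rightarrow> 'a \<Rightarrow> nat \<Rightarrow> complex poly" where
  "moment_poly F a n = (THE p. \<forall>N. poly p (of_nat N) = F (dot N a ^ n))"

text \<open>
  Applied to the three functionals of the \<open>\<alpha>\<close>-free product of copies of one probability space,
  this gives \<open>\<lambda>\<^sub>t\<close>, \<open>\<mu>\<^sub>t\<close> and \<open>\<nu>\<^sub>t\<close>.
\<close>

definition convolution_group ::
    "((nat, 'a::complex_algebra_1) free_product \<Rightarrow> complex) \<Rightarrow> 'a \<Rightarrow> real
      \<Rightarrow> complex poly \<Rightarrow> complex" where
  "convolution_group F a t =
     distribution_of_moments (\<lambda>n. poly (moment_poly F a n) (of_real t))"

section \<open>Formal Laurent series in \<open>1/z\<close>\<close>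

text \<open>
  Here \<open>fls_X\<close> stands for \<open>1/z\<close>. Hence \<open>d/dz = - X\<^sup>2 d/dX\<close>, and substituting \<open>F(z)\<close> for \<open>z\<close>
  means substituting \<open>1/F\<close> for \<open>X\<close>; for \<open>F = z + O(1)\<close> the series \<open>1/F\<close> has no constant term
  and no negative powers of \<open>X\<close>.
\<close>

definition G_transform :: "(complex poly \<Rightarrow> complex) \<Rightarrow> complex fls" where
  "G_transform \<mu> = fps_to_fls (Abs_fps (\<lambda>n. \<mu> (monom 1 n)) * fps_X)"

definition F_transform :: "(complex poly \<Rightarrow> complex) \<Rightarrow> complex fls" where
  "F_transform \<mu> = 1 / G_transform \<mu>"

definition z_deriv :: "complex fls \<Rightarrow> complex fls" where
  "z_deriv f = - (fls_X ^ 2 * fls_deriv f)"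

definition z_compose :: "complex fls \<Rightarrow> complex fls \<Rightarrow> complex fls"  (infixl "\<circ>\<^sub>z" 75) where
  "f \<circ>\<^sub>z F = fls_compose_fps f (fls_regpart (1 / F))"

text \<open>
  The \<open>t\<close>-derivative is taken coefficientwise; \<open>has_t_deriv\<close> includes the differentiability of
  every coefficient.
\<close>

definition has_t_deriv :: "(real \<Rightarrow> complex fls) \<Rightarrow> complex fls \<Rightarrow> real \<Rightarrow> bool" where
  "has_t_deriv H D t \<longleftrightarrow>
     (\<forall>k. ((\<lambda>s. fls_nth (H s) k) has_vector_derivative fls_nth D k) (at t))"

definition t_deriv :: "(real \<Rightarrow> complex fls) \<Rightarrow> real \<Rightarrow> complex fls" where
  "t_deriv H t = (THE D. has_t_deriv H D t)"

end

theory Submission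
  imports Defs
begin

text \<open>
  Split the first \<open>N + M\<close> copies of the algebra into the lower and the upper ones. The two blocks
  generate subalgebras that satisfy the same centring conditions as the individual copies: inside an
  alternating product, elements of the upper block are centred by \<open>\<Psi>\<close>, those of the lower block by
  \<open>\<Theta>\<close>. Let \<open>x\<close> be the sum over a block of \<open>N\<close> copies and \<open>y\<close> the sum over the other one, of \<open>M\<close>
  copies. The moments of \<open>y\<close> are polynomials in \<open>M\<close> without constant term, so to first order
  in \<open>M\<close> every power of \<open>x\<close> between two factors \<open>y\<close> may be replaced by its expectation under the
  interior functional of its block. Summing over all words in \<open>x\<close> and \<open>y\<close> gives the derivative of the
  moment series of the \<open>N\<close>-fold sum in terms of the linear coefficients of the moments of \<open>y\<close>, which are
  the coefficients of \<open>- B\<close> and \<open>- C\<close>. For the functional \<open>d\<close>, the interior functional \<open>b\<close> of the large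
  block and the other functional \<open>\<not> b\<close>, the outcome is
  \[ \partial_t F_d = B_d \circ F_b + (B_{\neg b} \circ F_b)(\partial_z F_d - 1), \]
  which yields the first four equations for the four choices of \<open>b\<close> and \<open>d\<close>. Polynomiality in \<open>N\<close> extends
  it to real times, and eliminating \<open>\<partial>\<^sub>z F\<^sub>d\<close> gives the last two equations.
\<close>

section \<open>Unital linear functionals and the embeddings of the copies\<close>

unbundle no vec_syntax

interpretation complex_algebra: vector_space "scaleC :: complex \<Rightarrow> 'a \<Rightarrow> 'a::complex_algebra_1"
  by unfold_locales (rule scaleC_add_right scaleC_add_left scaleC_scaleC scaleC_one)+

lemma linear_iff_scaleC:
  "Vector_Spaces.linear scaleC (*) f \<longleftrightarrow>
     (\<forall>x y. f (x + y) = f x + f y) \<and> (\<forall>c x. f (c *\<^sub>C x) = c * f x)"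
  for f :: "'a::complex_algebra_1 \<Rightarrow> complex"
  unfolding Vector_Spaces.linear_def module_hom_def module_hom_axioms_def
  by (auto simp: complex_algebra.module_axioms complex_algebra.vector_space_axioms
      vector_space_over_itself.vector_space_axioms vector_space_over_itself.module_axioms)

locale unital_functional =
  fixes f :: "'a::complex_algebra_1 \<Rightarrow> complex"
  assumes unital_linear: "unital_linear f"
begin

lemma add [simp]: "f (x + y) = f x + f y"
  and scaleC [simp]: "f (c *\<^sub>C x) = c * f x"
  and one [simp]: "f 1 = 1"
  using unital_linear by (auto simp: unital_linear_def linear_iff_scaleC)

lemma zero [simp]: "f 0 = 0"
  using scaleC[of 0 0] by simp

lemma diff [simp]: "f (x - y) = f x - f y"
  using add[of "x - y" y] by (simp del: add)

lemma sum: "f (sum g A) = (\<Sum>i\<in>A. f (g i))"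
  by (induction A rule: infinite_finite_induct) auto

end

lemma embed_add: "embed i (x + y) = embed i x + embed i y"
  by transfer (simp add: free_product_cong_def free_product_ideal.letter_add)

lemma embed_scaleC: "embed i (c *\<^sub>C x) = c *\<^sub>C embed i x"
  by transfer (simp add: free_product_cong_def free_product_ideal.letter_scaleC)

lemma embed_mult: "embed i (x * y) = embed i x * embed i y"
  by transfer (simp add: free_product_cong_def free_product_ideal.letter_mult)

lemma embed_one: "embed i 1 = 1"
  by transfer (simp add: free_product_cong_def free_product_ideal.letter_one)

section \<open>Centred words\<close>

text \<open>Keeping the relabelling \<open>f\<close> as a parameter lets one abstract word be
  evaluated at several index assignments, so that the values can be compared.\<close>

definition word_prod :: "('j \<Rightarrow> 'i) \<Rightarrow> ('j \<times> 'a::complex_algebra_1) list \<Rightarrow> ('i, 'a) free_product" where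
  "word_prod f w = prod_list (map (\<lambda>(i, x). embed (f i) x) w)"

lemma word_prod_simps [simp]:
  "word_prod f [] = 1"
  "word_prod f ((i, x) # w) = embed (f i) x * word_prod f w"
  by (simp_all add: word_prod_def)

lemma word_prod_append [simp]: "word_prod f (v @ w) = word_prod f v * word_prod f w"
  by (simp add: word_prod_def)

lemma word_prod_map: "word_prod f (map (map_prod g id) w) = word_prod (f \<circ> g) w"
  by (induction w) auto

lemma word_prod_eq_map2: "word_prod id w = prod_list (map2 embed (map fst w) (map snd w))"
  by (induction w) auto

text \<open>
  The centring functional of a letter depends on whether its neighbours have smaller or larger
  indices. A left context assigns the functional to the comparison \<open>r\<close> with the right neighbour:
  \<open>Some True\<close> if that neighbour is larger, \<open>Some False\<close> if it is smaller, \<open>None\<close> at the end of the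
  word. In \<open>step_context\<close> the flag tells whether the left neighbour is smaller.
\<close>

type_synonym 'a left_context = "bool option \<Rightarrow> 'a \<Rightarrow> complex"

definition step_context :: "('a \<Rightarrow> complex) \<Rightarrow> ('a \<Rightarrow> complex) \<Rightarrow> bool \<Rightarrow> 'a left_context" where
  "step_context \<psi> \<theta> b r =
     (if r = Some (\<not> b) then (if b then \<psi> else \<theta>) else (\<lambda>_. 0))"

text \<open>The comparison \<open>r\<close> refers to a letter still to follow, so that pieces of a
  longer word can be centred separately and then joined. The empty word is excluded because unital
  functionals take the value 1 there.\<close>

fun centred ::
    "('a \<Rightarrow> complex) \<Rightarrow> ('a \<Rightarrow> complex) \<Rightarrow> 'a left_context
      \<Rightarrow> ('i::linorder \<times> 'a) list \<Rightarrow> bool option \<Rightarrow> bool" where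
  "centred \<psi> \<theta> l [] r = False"
| "centred \<psi> \<theta> l [(i, x)] r = (l r x = 0)"
| "centred \<psi> \<theta> l ((i, x) # (j, y) # w) r =
     (i \<noteq> j \<and> l (Some (i < j)) x = 0 \<and>
      centred \<psi> \<theta> (step_context \<psi> \<theta> (i < j)) ((j, y) # w) r)"

lemma centred_nonempty: "centred \<psi> \<theta> l w r \<Longrightarrow> w \<noteq> []"
  by (cases w) auto

text \<open>Centring depends only on comparisons between neighbouring indices, and these survive a
  strictly increasing relabelling.\<close>

lemma centred_strict_mono_on:
  assumes "strict_mono_on A f" "fst ` set w \<subseteq> A"
  shows "centred \<psi> \<theta> l (map (map_prod f id) w) r = centred \<psi> \<theta> l w r"
  using assms(2)
  by (induction \<psi> \<theta> l w r rule: centred.induct)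
    (use assms(1) in \<open>auto simp: strict_mono_on_less strict_mono_on_eqD\<close>)

lemma centred_append:
  assumes "centred \<psi> \<theta> l v (Some b)" "centred \<psi> \<theta> (step_context \<psi> \<theta> b) w r"
    and "fst (last v) \<noteq> fst (hd w)" "(fst (last v) < fst (hd w)) = b"
  shows "centred \<psi> \<theta> l (v @ w) r"
  using assms
proof (induction \<psi> \<theta> l v "Some b" rule: centred.induct)
  case (2 \<psi> \<theta> l i x)
  then show ?case by (cases w) auto
qed auto

text \<open>After the first letter the context is \<open>step_context\<close>, which is the zero
  functional at the end of a word; only a word of a single letter still sees \<open>l\<close>
  there.\<close>

lemma centred_right_None:
  assumes "centred \<psi> \<theta> l w r" "\<And>x r. length w = 1 \<Longrightarrow> l r x = 0 \<Longrightarrow> l None x = 0"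
  shows "centred \<psi> \<theta> l w None"
  using assms
  by (induction \<psi> \<theta> l w r rule: centred.induct) (auto simp: step_context_def)

text \<open>This turns the recursive condition into one on list positions, as in
  \<open>position_functional\<close>. The last position is left out because it is neither a peak nor
  a bottom.\<close>

lemma centred_step_nth:
  assumes "centred \<psi> \<theta> (step_context \<psi> \<theta> b) w r"
  shows "distinct_adj (map fst w) \<and>
    (\<forall>k. Suc k < length w \<longrightarrow>
      step_context \<psi> \<theta> (if k = 0 then b else fst (w ! (k - 1)) < fst (w ! k))
        (Some (fst (w ! k) < fst (w ! Suc k))) (snd (w ! k)) = 0)"
  using assms
proof (induction \<psi> \<theta> "step_context \<psi> \<theta> b" w r arbitrary: b rule: centred.induct)
  case (3 \<psi> \<theta> i x j y w r)
  then have "i \<noteq> j" and x: "step_context \<psi> \<theta> b (Some (i < j)) x = 0"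
    and "centred \<psi> \<theta> (step_context \<psi> \<theta> (i < j)) ((j, y) # w) r"
    by simp_all
  with 3(1) have IH: "distinct_adj (map fst ((j, y) # w))"
    "\<And>k. Suc k < length ((j, y) # w) \<Longrightarrow>
      step_context \<psi> \<theta> (if k = 0 then i < j else fst (((j, y) # w) ! (k - 1)) < fst (((j, y) # w) ! k))
        (Some (fst (((j, y) # w) ! k) < fst (((j, y) # w) ! Suc k))) (snd (((j, y) # w) ! k)) = 0"
    by blast+
  have "step_context \<psi> \<theta>
      (if k = 0 then b
       else fst (((i, x) # (j, y) # w) ! (k - 1)) < fst (((i, x) # (j, y) # w) ! k))
      (Some (fst (((i, x) # (j, y) # w) ! k) < fst (((i, x) # (j, y) # w) ! Suc k)))
      (snd (((i, x) # (j, y) # w) ! k)) = 0"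
    if "Suc k < length ((i, x) # (j, y) # w)" for k
  proof (cases k)
    case 0
    with x show ?thesis by simp
  next
    case (Suc m)
    with IH(2)[of m] that show ?thesis by (cases m) simp_all
  qed
  with IH(1) \<open>i \<noteq> j\<close> show ?case by simp
qed auto

lemma vanishes_on_centredD:
  assumes "vanishes_on_centred (\<lambda>_. \<omega>) (\<lambda>_. \<psi>) (\<lambda>_. \<theta>) F" "centred \<psi> \<theta> (\<lambda>_. \<omega>) w r"
  shows "F (word_prod id w) = 0"
proof -
  obtain i x v where w: "w = (i, x) # v"
    using centred_nonempty[OF assms(2)] by (cases w) auto
  have x: "\<omega> x = 0"
    using assms(2) w by (cases v) auto
  have v: "v \<noteq> [] \<Longrightarrow> i \<noteq> fst (hd v) \<and>
      centred \<psi> \<theta> (step_context \<psi> \<theta> (i < fst (hd v))) v r"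
    using assms(2) w by (cases v) auto
  have "distinct_adj (map fst w) \<and>
    (\<forall>k < length w. position_functional (\<lambda>_. \<omega>) (\<lambda>_. \<psi>) (\<lambda>_. \<theta>) (map fst w) k (snd (w ! k)) = 0)"
  proof (cases "v = []")
    case True
    with x w show ?thesis by (auto simp: position_functional_def)
  next
    case False
    note s = centred_step_nth[OF conjunct2[OF v[OF False]]]
    have "distinct_adj (map fst w)"
      using s v[OF False] False w by (auto simp: distinct_adj_Cons hd_map)
    moreover have "position_functional (\<lambda>_. \<omega>) (\<lambda>_. \<psi>) (\<lambda>_. \<theta>) (map fst w) k (snd (w ! k)) = 0"
      if k: "k < length w" for k
    proof (cases k)
      case 0
      then show ?thesis using x w by (simp add: position_functional_def)
    next
      case (Suc m)
      have hd: "fst (hd v) = fst (v ! 0)" using False by (simp add: hd_conv_nth)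
      show ?thesis
      proof (cases "Suc m < length v")
        case False
        then show ?thesis using Suc w by (simp add: position_functional_def Peak_def Bot_def)
      next
        case True
        then have "step_context \<psi> \<theta> (if m = 0 then i < fst (v ! 0) else fst (v ! (m - 1)) < fst (v ! m))
            (Some (fst (v ! m) < fst (v ! Suc m))) (snd (v ! m)) = 0"
          using s hd by auto
        then show ?thesis using True Suc w False
          by (cases m) (auto simp: position_functional_def Peak_def Bot_def step_context_def
              split: if_splits)
      qed
    qed
    ultimately show ?thesis by blast
  qed
  then show ?thesis
    using assms(1)[unfolded vanishes_on_centred_def, THEN spec, THEN spec, of "map fst w" "map snd w"]
      centred_nonempty[OF assms(2)]
    by (simp add: word_prod_eq_map2)
qed

text \<open>Elements are functions of the relabelling \<open>f\<close>, not single vectors: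
  membership therefore provides one linear combination whose coefficients and words are the same for
  all \<open>f\<close>.\<close>

inductive_set word_span :: "('i \<times> 'a::complex_algebra_1) list set \<Rightarrow> (('i \<Rightarrow> 'j) \<Rightarrow> ('j, 'a) free_product) set"
  for V where
  word: "v \<in> V \<Longrightarrow> (\<lambda>f. word_prod f v) \<in> word_span V"
| zero: "(\<lambda>f. 0) \<in> word_span V"
| add: "g \<in> word_span V \<Longrightarrow> h \<in> word_span V \<Longrightarrow> (\<lambda>f. g f + h f) \<in> word_span V"
| scale: "g \<in> word_span V \<Longrightarrow> (\<lambda>f. c *\<^sub>C g f) \<in> word_span V"

lemma word_span_trans:
  fixes g :: "('i \<Rightarrow> 'j) \<Rightarrow> ('j, 'a::complex_algebra_1) free_product"
  assumes "g \<in> word_span V" "\<And>v. v \<in> V \<Longrightarrow> (\<lambda>f::'i \<Rightarrow> 'j. word_prod f v) \<in> word_span W"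
  shows "g \<in> word_span W"
  using assms(1) by induction (auto intro: assms(2) word_span.intros)

lemma word_span_mono: "g \<in> word_span V \<Longrightarrow> V \<subseteq> W \<Longrightarrow> g \<in> word_span W"
  by (rule word_span_trans) (auto intro: word_span.word)

lemma word_span_Cons:
  assumes "g \<in> word_span V"
  shows "(\<lambda>f. embed (f i) x * g f) \<in> word_span ((#) (i, x) ` V)"
  using assms
proof induction
  case (word v)
  then have "(\<lambda>f. word_prod f ((i, x) # v)) \<in> word_span ((#) (i, x) ` V)"
    by (intro word_span.word) auto
  then show ?case by simp
qed (auto simp: distrib_left mult_scaleC_right intro: word_span.intros)

text \<open>When a letter is written as \<open>x - c *\<^sub>C 1\<close> plus a scalar, the scalar
  part deletes the letter. Changing letters by scalars thus costs only shorter words.\<close>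

lemma word_diff_in_word_span:
  fixes w w' :: "('i \<times> 'a::complex_algebra_1) list"
  assumes "list_all2 (\<lambda>(i, x) (j, y). i = j \<and> (\<exists>c. y = x - c *\<^sub>C 1)) w w'"
  shows "(\<lambda>f::'i \<Rightarrow> 'j. word_prod f w - word_prod f w')
    \<in> word_span {v. length v < length w \<and> fst ` set v \<subseteq> fst ` set w}"
  using assms
proof (induction rule: list_all2_induct)
  case Nil
  then show ?case by (simp add: word_span.zero)
next
  case (Cons p w q w')
  obtain i x c where p: "p = (i, x)" "q = (i, x - c *\<^sub>C 1)"
    using Cons(1) by (cases p; cases q) auto
  let ?V = "{v. length v < length (p # w) \<and> fst ` set v \<subseteq> fst ` set (p # w)}"
  have "(\<lambda>f::'i \<Rightarrow> 'j. embed (f i) (x - c *\<^sub>C 1) * (word_prod f w - word_prod f w')) \<in> word_span ?V"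
    by (rule word_span_mono[OF word_span_Cons[OF Cons(3)]]) (use p in fastforce)
  moreover have "(\<lambda>f::'i \<Rightarrow> 'j. c *\<^sub>C word_prod f w) \<in> word_span ?V"
    by (intro word_span.scale word_span.word) auto
  ultimately have h: "(\<lambda>f::'i \<Rightarrow> 'j. embed (f i) (x - c *\<^sub>C 1) * (word_prod f w - word_prod f w')
      + c *\<^sub>C word_prod f w) \<in> word_span ?V"
    by (rule word_span.add)
  have eq: "embed (f i) (x - c *\<^sub>C 1) * (word_prod f w - word_prod f w') + c *\<^sub>C word_prod f w
      = word_prod f (p # w) - word_prod f (q # w')" for f :: "'i \<Rightarrow> 'j"
  proof -
    have "embed (f i) (x - c *\<^sub>C 1) = embed (f i) x - c *\<^sub>C 1"
      using embed_add[of "f i" "x - c *\<^sub>C 1" "c *\<^sub>C 1"]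
      by (simp add: embed_scaleC embed_one algebra_simps)
    then show ?thesis
      by (simp add: p left_diff_distrib right_diff_distrib mult_scaleC_left
          complex_algebra.scale_right_diff_distrib)
  qed
  from h show ?case unfolding eq .
qed

text \<open>Neighbouring letters from the same copy multiply inside that copy and fuse into one
  letter.\<close>

lemma not_distinct_adj_shorten:
  fixes w :: "('i \<times> 'a::complex_algebra_1) list"
  assumes "\<not> distinct_adj (map fst w)"
  obtains v where "length v < length w" "fst ` set v \<subseteq> fst ` set w"
    "\<And>f::'i \<Rightarrow> 'j. word_prod f v = word_prod f w"
proof -
  have "\<exists>v. length v < length w \<and> fst ` set v \<subseteq> fst ` set w \<and>
      (\<forall>f::'i \<Rightarrow> 'j. word_prod f v = word_prod f w)"
    using assms
  proof (induction "map fst w" arbitrary: w rule: induct_list012)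
    case (3 i j js)
    then obtain x y u where w: "w = (i, x) # (j, y) # u"
      by (cases w; cases "tl w") auto
    show ?case
    proof (cases "i = j")
      case True
      then show ?thesis using w
        by (intro exI[of _ "(i, x * y) # u"]) (auto simp: embed_mult mult.assoc)
    next
      case False
      then have "\<not> distinct_adj (map fst ((j, y) # u))" using 3(4) w by simp
      from 3(2)[OF _ this] 3(3) w obtain v
        where v: "length v < length ((j, y) # u)" "fst ` set v \<subseteq> fst ` set ((j, y) # u)"
          "\<forall>f::'i \<Rightarrow> 'j. word_prod f v = word_prod f ((j, y) # u)"
        by auto
      show ?thesis
        by (rule exI[of _ "(i, x) # v"]) (use v w in auto)
    qed
  qed auto
  then show thesis using that by blast
qed

text \<open>A unital functional kills \<open>x\<close> minus its own value times 1, and the zero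
  functional kills everything, so both kinds of context have this property.\<close>

definition centrable :: "'a::complex_algebra_1 left_context \<Rightarrow> bool" where
  "centrable l \<longleftrightarrow> (\<forall>r x. \<exists>c. l r (x - c *\<^sub>C 1) = 0)"

lemma (in unital_functional) centring: "f (x - f x *\<^sub>C 1) = 0"
  by simp

lemma centrable_const: "unital_linear \<omega> \<Longrightarrow> centrable (\<lambda>_. \<omega>)"
  unfolding centrable_def using unital_functional.centring unital_functional.intro by blast

lemma centrable_step_context:
  "unital_linear \<psi> \<Longrightarrow> unital_linear \<theta> \<Longrightarrow> centrable (step_context \<psi> \<theta> b)"
  using centrable_const[of \<psi>] centrable_const[of \<theta>] by (simp add: centrable_def step_context_def)

text \<open>Subtracting scalars leaves the indices alone, so the functional at each position is
  known from the start and each letter can be centred by its own scalar.\<close>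

lemma exists_centred:
  assumes "centrable l" "unital_linear \<psi>" "unital_linear \<theta>" "distinct_adj (map fst w)" "w \<noteq> []"
  shows "\<exists>w'. list_all2 (\<lambda>(i, x) (j, y). i = j \<and> (\<exists>c. y = x - c *\<^sub>C 1)) w w' \<and> centred \<psi> \<theta> l w' r"
  using assms(1,4,5)
proof (induction w arbitrary: l)
  case (Cons p w)
  obtain i x where p: "p = (i, x)" by (cases p)
  show ?case
  proof (cases w)
    case Nil
    obtain c where "l r (x - c *\<^sub>C 1) = 0" using Cons(2) by (auto simp: centrable_def)
    with Nil p show ?thesis by (intro exI[of _ "[(i, x - c *\<^sub>C 1)]"]) auto
  next
    case (Cons q v)
    obtain j y where q: "q = (j, y)" by (cases q)
    obtain c where c: "l (Some (i < j)) (x - c *\<^sub>C 1) = 0"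
      using Cons.prems(1) by (auto simp: centrable_def)
    have dw: "distinct_adj (map fst w)" "w \<noteq> []"
      using Cons.prems Cons p q by simp_all
    obtain w' where w': "list_all2 (\<lambda>(i, x) (j, y). i = j \<and> (\<exists>c. y = x - c *\<^sub>C 1)) w w'"
      "centred \<psi> \<theta> (step_context \<psi> \<theta> (i < j)) w' r"
      using Cons.IH[OF centrable_step_context[OF assms(2,3)], of "i < j"] dw by blast
    moreover obtain y' v' where "w' = (j, y') # v'"
      using w'(1) Cons q by (auto simp: list_all2_Cons1)
    moreover have "i \<noteq> j" using Cons.prems Cons p q by simp
    ultimately show ?thesis using c p
      by (intro exI[of _ "(i, x - c *\<^sub>C 1) # w'"]) auto
  qed
qed simp

text \<open>Induction on the length: equal neighbouring indices allow a shorter word for the same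
  product; otherwise the word differs from a centred one by shorter words.\<close>

lemma word_prod_in_centred_span:
  fixes w :: "('i::linorder \<times> 'a::complex_algebra_1) list"
  assumes "centrable l" "unital_linear \<psi>" "unital_linear \<theta>"
  shows "(\<lambda>f::'i \<Rightarrow> 'j. word_prod f w)
    \<in> word_span {v. (v = [] \<or> centred \<psi> \<theta> l v r) \<and> fst ` set v \<subseteq> fst ` set w}"
proof (induction w rule: length_induct)
  case (1 w)
  let ?V = "\<lambda>w. {v. (v = [] \<or> centred \<psi> \<theta> l v r) \<and> fst ` set v \<subseteq> fst ` set w}"
  have IH: "(\<lambda>f::'i \<Rightarrow> 'j. word_prod f v) \<in> word_span (?V w)"
    if "length v < length w" "fst ` set v \<subseteq> fst ` set w" for v
    by (rule word_span_mono[of _ "?V v"]) (use 1 that in \<open>blast+\<close>)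
  consider "w = []" | "w \<noteq> []" "distinct_adj (map fst w)" | "\<not> distinct_adj (map fst w)" by blast
  then show ?case
  proof cases
    case 1
    then show ?thesis by (intro word_span.word) auto
  next
    case 2
    from exists_centred[OF assms this(2,1)] obtain w'
      where w': "list_all2 (\<lambda>(i, x) (j, y). i = j \<and> (\<exists>c. y = x - c *\<^sub>C 1)) w w'"
        "centred \<psi> \<theta> l w' r" by blast
    have "map fst w = map fst w'"
      using w'(1) by (induction rule: list_all2_induct) auto
    then have "fst ` set w' = fst ` set w" by (metis list.set_map)
    then have "(\<lambda>f::'i \<Rightarrow> 'j. word_prod f w') \<in> word_span (?V w)"
      using w'(2) by (intro word_span.word) auto
    moreover have "(\<lambda>f::'i \<Rightarrow> 'j. word_prod f w - word_prod f w') \<in> word_span (?V w)"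
      by (rule word_span_trans[OF word_diff_in_word_span[OF w'(1)]]) (use IH in auto)
    ultimately have "(\<lambda>f::'i \<Rightarrow> 'j. word_prod f w' + (word_prod f w - word_prod f w')) \<in> word_span (?V w)"
      by (rule word_span.add)
    then show ?thesis by simp
  next
    case 3
    then obtain v where "length v < length w" "fst ` set v \<subseteq> fst ` set w"
      "\<And>f::'i \<Rightarrow> 'j. word_prod f v = word_prod f w"
      by (rule not_distinct_adj_shorten) blast
    with IH[of v] show ?thesis by simp
  qed
qed

text \<open>Both values come from one expansion into centred words whose coefficients do not depend
  on the relabelling. Nonempty centred words are annihilated before and after relabelling, so only
  the coefficient of the empty word remains.\<close>

theorem word_prod_strict_mono_invariant:
  assumes "unital_linear F" "unital_linear \<omega>" "unital_linear \<psi>" "unital_linear \<theta>"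
    and "vanishes_on_centred (\<lambda>_. \<omega>) (\<lambda>_. \<psi>) (\<lambda>_. \<theta>) F"
    and f: "strict_mono_on A f" "fst ` set w \<subseteq> A"
  shows "F (word_prod f w) = F (word_prod id w)"
proof -
  interpret F: unital_functional F by unfold_locales fact
  have "F (g f) = F (g id)"
    if "g \<in> word_span {v. (v = [] \<or> centred \<psi> \<theta> (\<lambda>_. \<omega>) v None) \<and> fst ` set v \<subseteq> fst ` set w}" for g
    using that
  proof induction
    case (word v)
    show ?case
    proof (cases "v = []")
      case False
      then have "centred \<psi> \<theta> (\<lambda>_. \<omega>) v None" "centred \<psi> \<theta> (\<lambda>_. \<omega>) (map (map_prod f id) v) None"
        using word f by (auto simp: centred_strict_mono_on[OF f(1)])
      from this[THEN vanishes_on_centredD[OF assms(5)], unfolded word_prod_map] show ?thesis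
        by (simp add: id_def comp_def)
    qed simp
  qed simp_all
  from this[OF word_prod_in_centred_span[OF centrable_const]] assms show ?thesis by blast
qed

section \<open>Spreadability and polynomial moments\<close>

lemma sum_embed_power:
  fixes f :: "'j \<Rightarrow> 'i"
  assumes "finite J"
  shows "(\<Sum>j\<in>J. embed (f j) x) ^ n =
    (\<Sum>js | set js \<subseteq> J \<and> length js = n. word_prod f (map (\<lambda>j. (j, x)) js))"
proof (induction n)
  case 0
  have "{js. set js \<subseteq> J \<and> length js = 0} = {[]}" by auto
  then show ?case by simp
next
  case (Suc n)
  have inj: "inj_on (\<lambda>(js, j). j # js) ({js. set js \<subseteq> J \<and> length js = n} \<times> J)"
    by (auto simp: inj_on_def)
  have "(\<Sum>j\<in>J. embed (f j) x) ^ Suc n =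
      (\<Sum>j\<in>J. embed (f j) x) * (\<Sum>js | set js \<subseteq> J \<and> length js = n. word_prod f (map (\<lambda>j. (j, x)) js))"
    by (simp add: Suc)
  also have "\<dots> = (\<Sum>j\<in>J. \<Sum>js | set js \<subseteq> J \<and> length js = n.
      embed (f j) x * word_prod f (map (\<lambda>j. (j, x)) js))"
    by (simp only: sum_product)
  also have "\<dots> = (\<Sum>js | set js \<subseteq> J \<and> length js = n. \<Sum>j\<in>J.
      word_prod f (map (\<lambda>j. (j, x)) (j # js)))"
    by (subst sum.swap) simp
  also have "\<dots> = (\<Sum>js | set js \<subseteq> J \<and> length js = Suc n. word_prod f (map (\<lambda>j. (j, x)) js))"
    unfolding lists_length_Suc_eq
    by (subst sum.reindex[OF inj]) (simp add: sum.cartesian_product case_prod_unfold)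
  finally show ?case .
qed

locale spreadable_functional = unital_functional F
  for F :: "(nat, 'a::complex_algebra_1) free_product \<Rightarrow> complex" +
  assumes spreadable:
    "strict_mono_on A f \<Longrightarrow> fst ` set w \<subseteq> A \<Longrightarrow> F (word_prod f w) = F (word_prod id w)"
begin

lemma moment_reindex:
  assumes "finite J" "strict_mono_on J f"
  shows "F ((\<Sum>j\<in>J. embed (f j) x) ^ n) = F ((\<Sum>j\<in>J. embed j x) ^ n)"
  using sum_embed_power[OF assms(1), of f x n] sum_embed_power[OF assms(1), of id x n]
  by (auto simp: sum intro!: sum.cong spreadable[OF assms(2)])

text \<open>Expand the power into index sequences and group them by the set of indices that occur.
  By spreadability the contribution of a set depends only on its cardinality, and \<open>n\<close>
  factors involve at most \<open>n\<close> indices.\<close>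

lemma moment_eq_sum_choose:
  obtains d where "\<And>N. F (dot N a ^ n) = (\<Sum>k\<le>n. of_nat (N choose k) * d k)"
proof -
  define c where "c js = F (word_prod id (map (\<lambda>j. (j, a)) js))" for js
  define h where "h S = (\<Sum>js | set js = S \<and> length js = n. c js)" for S
  have h_card: "h S = h {..<card S}" if S: "finite S" for S
  proof -
    \<comment> \<open>The increasing enumeration of \<open>S\<close> carries the sequences with
      index set \<open>{..<card S}\<close> to those with index set \<open>S\<close> and preserves
      their values.\<close>
    obtain f where f: "bij_betw f {..<card S} S" "strict_mono_on {..<card S} f"
      using ex_bij_betw_strict_mono_card[OF S] by blast
    have inj: "inj_on f {..<card S}" and im: "f ` {..<card S} = S"
      using f(1) by (auto simp: bij_betw_def)
    have "bij_betw (map f) {js. set js = {..<card S} \<and> length js = n}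
        {js. set js = S \<and> length js = n}"
    proof (rule bij_betw_byWitness[where f' = "map (inv_into {..<card S} f)"])
      show "\<forall>js\<in>{js. set js = {..<card S} \<and> length js = n}.
          map (inv_into {..<card S} f) (map f js) = js"
        unfolding map_map using inj by (intro ballI map_idI) simp
      show "\<forall>js\<in>{js. set js = S \<and> length js = n}.
          map f (map (inv_into {..<card S} f) js) = js"
        unfolding map_map using im by (intro ballI map_idI) (simp add: f_inv_into_f)
      show "map f ` {js. set js = {..<card S} \<and> length js = n} \<subseteq> {js. set js = S \<and> length js = n}"
        using im by auto
      have "inv_into {..<card S} f ` S = {..<card S}"
        using inj im by (metis inv_into_image_cancel subset_refl)
      then show "map (inv_into {..<card S} f) ` {js. set js = S \<and> length js = n}
          \<subseteq> {js. set js = {..<card S} \<and> length js = n}"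
        by auto
    qed
    then have "h S = (\<Sum>js | set js = {..<card S} \<and> length js = n. c (map f js))"
      unfolding h_def by (rule sum.reindex_bij_betw[symmetric])
    also have "\<dots> = h {..<card S}"
      unfolding h_def
    proof (intro sum.cong refl)
      fix js assume "js \<in> {js. set js = {..<card S} \<and> length js = n}"
      then have sub: "fst ` set (map (\<lambda>j. (j, a)) js) \<subseteq> {..<card S}"
        by (simp add: image_image)
      have "map (\<lambda>j. (j, a)) (map f js) = map (map_prod f id) (map (\<lambda>j. (j, a)) js)" by simp
      then have "c (map f js) = F (word_prod f (map (\<lambda>j. (j, a)) js))"
        unfolding c_def by (simp only: word_prod_map id_comp)
      then show "c (map f js) = c js"
        unfolding c_def using spreadable[OF f(2) sub] by simp
    qed
    finally show ?thesis .
  qed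
  have "F (dot N a ^ n) = (\<Sum>k\<le>n. of_nat (N choose k) * h {..<k})" for N
  proof -
    have fin: "finite {js. set js \<subseteq> {..<N} \<and> length js = n}"
      by (rule finite_lists_length_eq) simp
    have "F (dot N a ^ n) = (\<Sum>js | set js \<subseteq> {..<N} \<and> length js = n. c js)"
      using sum_embed_power[of "{..<N}" id a n] by (simp add: dot_def c_def sum)
    also have "\<dots> = (\<Sum>S\<in>Pow {..<N}. \<Sum>js\<in>{js \<in> {js. set js \<subseteq> {..<N} \<and> length js = n}. set js = S}. c js)"
      by (rule sum.group[symmetric]) (use fin in auto)
    also have "\<dots> = (\<Sum>S\<in>Pow {..<N}. h S)"
      unfolding h_def by (intro sum.cong) auto
    also have "\<dots> = (\<Sum>S\<in>Pow {..<N}. h {..<card S})"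
      by (intro sum.cong refl h_card) (auto intro: finite_subset)
    also have "\<dots> = (\<Sum>k\<le>N. \<Sum>S\<in>{S\<in>Pow {..<N}. card S = k}. h {..<card S})"
      by (rule sum.group[symmetric]) (auto dest: card_mono[rotated])
    also have "\<dots> = (\<Sum>k\<le>N. of_nat (N choose k) * h {..<k})"
      using n_subsets[of "{..<N}"] by (intro sum.cong refl) (simp add: conj_commute)
    also have "\<dots> = (\<Sum>k\<le>max n N. of_nat (N choose k) * h {..<k})"
      by (intro sum.mono_neutral_left) auto
    also have "\<dots> = (\<Sum>k\<le>n. of_nat (N choose k) * h {..<k})"
    proof (intro sum.mono_neutral_right)
      show "\<forall>k\<in>{..max n N} - {..n}. of_nat (N choose k) * h {..<k} = 0"
      proof
        fix k assume "k \<in> {..max n N} - {..n}"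
        then have "n < k" by auto
        then have e: "{js. set js = {..<k} \<and> length js = n} = {}"
          using card_length by (metis (mono_tags, lifting) Collect_empty_eq card_lessThan leD)
        then show "of_nat (N choose k) * h {..<k} = 0" unfolding h_def e by simp
      qed
    qed auto
    finally show ?thesis .
  qed
  then show thesis by (rule that)
qed

lemma exists_choose_poly: "\<exists>p :: complex poly. \<forall>N. poly p (of_nat N) = of_nat (N choose k)"
proof -
  let ?p = "smult (inverse (fact k)) (\<Prod>i<k. [:- of_nat i, 1:]) :: complex poly"
  have "poly ?p (of_nat N) = of_nat (N choose k)" for N
    by (simp add: binomial_gbinomial gbinomial_prod_rev poly_prod field_simps lessThan_atLeast0)
  then show ?thesis by blast
qed

lemma exists_moment_poly: "\<exists>p. \<forall>N. poly p (of_nat N) = F (dot N a ^ n)"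
proof -
  obtain d where d: "\<And>N. F (dot N a ^ n) = (\<Sum>k\<le>n. of_nat (N choose k) * d k)"
    by (rule moment_eq_sum_choose[of a n]) blast
  obtain q :: "nat \<Rightarrow> complex poly" where q: "\<And>k N. poly (q k) (of_nat N) = of_nat (N choose k)"
    using exists_choose_poly by metis
  have "poly (\<Sum>k\<le>n. smult (d k) (q k)) (of_nat N) = F (dot N a ^ n)" for N
    by (simp add: d poly_sum q mult.commute)
  then show ?thesis by blast
qed

end

lemma poly_eq_of_nat_eqI:
  fixes p q :: "complex poly"
  assumes "\<And>N. poly p (of_nat N) = poly q (of_nat N)"
  shows "p = q"
proof (rule ccontr)
  assume "p \<noteq> q"
  then have "finite {z. poly (p - q) z = 0}" by (intro poly_roots_finite) simp
  moreover have "range of_nat \<subseteq> {z. poly (p - q) z = 0}" using assms by auto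
  ultimately have "finite (range (of_nat :: nat \<Rightarrow> complex))" by (rule finite_subset[rotated])
  then show False
    using finite_imageD[OF _ inj_of_nat] infinite_UNIV_nat by blast
qed

text \<open>The definite description in \<open>moment_poly\<close> is meaningful: a polynomial
  exists, and its values at all natural numbers determine it.\<close>

lemma (in spreadable_functional) poly_moment_poly:
  "poly (moment_poly F a n) (of_nat N) = F (dot N a ^ n)"
proof -
  have "\<exists>!p. \<forall>N. poly p (of_nat N) = F (dot N a ^ n)"
    using exists_moment_poly[of a n] poly_eq_of_nat_eqI by metis
  from theI'[OF this] show ?thesis unfolding moment_poly_def by blast
qed

section \<open>Blocks of consecutive copies\<close>

lemma span_mult_induct:
  fixes u t :: "'u::complex_algebra_1"
  assumes "u \<in> complex_algebra.span U" "t \<in> complex_algebra.span V"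
    and S: "complex_algebra.subspace S" and "\<And>x y. x \<in> U \<Longrightarrow> y \<in> V \<Longrightarrow> x * y \<in> S"
  shows "u * t \<in> S"
proof -
  have 1: "x * t \<in> S" if "x \<in> U" for x
    using assms(2)
    by (induction rule: complex_algebra.span_induct_alt)
      (use that assms(4) S in \<open>auto simp: distrib_left mult_scaleC_right
        intro: complex_algebra.subspace_add complex_algebra.subspace_scale complex_algebra.subspace_0\<close>)
  show ?thesis
    using assms(1)
    by (induction rule: complex_algebra.span_induct_alt)
      (use 1 S in \<open>auto simp: distrib_right mult_scaleC_left
        intro: complex_algebra.subspace_add complex_algebra.subspace_scale complex_algebra.subspace_0\<close>)
qed

text \<open>Words with indices in \<open>I\<close> include the empty one and are closed under
  concatenation, so this span is the subalgebra generated by the copies in \<open>I\<close>.\<close>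

definition block :: "'i set \<Rightarrow> ('i, 'a::complex_algebra_1) free_product set" where
  "block I = complex_algebra.span (word_prod id ` {w. fst ` set w \<subseteq> I})"

lemma block_embed: "i \<in> I \<Longrightarrow> embed i x \<in> block I"
  unfolding block_def
  by (rule complex_algebra.span_base, rule image_eqI[where x = "[(i, x)]"]) auto

lemma block_one: "1 \<in> block I"
  unfolding block_def
  by (rule complex_algebra.span_base, rule image_eqI[where x = "[]"]) auto

lemma block_subspace: "complex_algebra.subspace (block I)"
  unfolding block_def by simp

lemmas block_add = complex_algebra.subspace_add[OF block_subspace]
  and block_scaleC = complex_algebra.subspace_scale[OF block_subspace]
  and block_sum = complex_algebra.subspace_sum[OF block_subspace]

lemma block_mult:
  assumes "x \<in> block I" "y \<in> block I" shows "x * y \<in> block I"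
proof (rule span_mult_induct[OF assms[unfolded block_def] block_subspace])
  fix u v :: "('a, 'b) free_product"
  assume "u \<in> word_prod id ` {w. fst ` set w \<subseteq> I}" "v \<in> word_prod id ` {w. fst ` set w \<subseteq> I}"
  then obtain p q where "fst ` set p \<subseteq> I" "fst ` set q \<subseteq> I" "u = word_prod id p" "v = word_prod id q"
    by blast
  then show "u * v \<in> block I"
    unfolding block_def
    by (intro complex_algebra.span_base image_eqI[where x = "p @ q"]) auto
qed

section \<open>Centring of block elements in the \<alpha>-free product\<close>

locale alpha_pair =
  fixes \<psi> \<theta> :: "'a::complex_algebra_1 \<Rightarrow> complex"
    and \<Psi> \<Theta> :: "('i::linorder, 'a) free_product \<Rightarrow> complex"
  assumes unital: "unital_linear \<psi>" "unital_linear \<theta>" "unital_linear \<Psi>" "unital_linear \<Theta>"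
    and vanishes: "vanishes_on_centred (\<lambda>_. \<psi>) (\<lambda>_. \<psi>) (\<lambda>_. \<theta>) \<Psi>"
      "vanishes_on_centred (\<lambda>_. \<theta>) (\<lambda>_. \<psi>) (\<lambda>_. \<theta>) \<Theta>"
begin

definition centred_span :: "'i set \<Rightarrow> 'a left_context \<Rightarrow> bool option \<Rightarrow> ('i, 'a) free_product set" where
  "centred_span I l r = complex_algebra.span (word_prod id ` {w. centred \<psi> \<theta> l w r \<and> fst ` set w \<subseteq> I})"

text \<open>These are the continuations of a word whose last index lies below (\<open>b\<close>
  true) or above the first index of the tail. Only that first letter is tied to \<open>I\<close>;
  afterwards the word may move between blocks.\<close>

definition tails :: "'i set \<Rightarrow> bool \<Rightarrow> ('i, 'a) free_product set" where
  "tails I b = complex_algebra.span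
     (word_prod id ` {w. centred \<psi> \<theta> (step_context \<psi> \<theta> b) w None \<and> fst (hd w) \<in> I})"

text \<open>\<open>True\<close> stands for the functional used at peaks and \<open>False\<close> for
  the one used at bottoms, so the same flag can record whether a block lies above its
  neighbours.\<close>

definition outer :: "bool \<Rightarrow> ('i, 'a) free_product \<Rightarrow> complex" where
  "outer b = (if b then \<Psi> else \<Theta>)"

definition inner :: "bool \<Rightarrow> 'a \<Rightarrow> complex" where
  "inner b = (if b then \<psi> else \<theta>)"

lemma unital_outer: "unital_linear (outer b)" and unital_inner: "unital_linear (inner b)"
  using unital by (auto simp: outer_def inner_def)

sublocale outer: unital_functional "outer b" for b
  by unfold_locales (rule unital_outer)

sublocale inner: unital_functional "inner b" for b
  by unfold_locales (rule unital_inner)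

lemma outer_centred: "centred \<psi> \<theta> (\<lambda>_. inner b) w r \<Longrightarrow> outer b (word_prod id w) = 0"
  using vanishes_on_centredD[OF vanishes(1)] vanishes_on_centredD[OF vanishes(2)]
  by (auto simp: outer_def inner_def split: if_splits)

text \<open>Each word is a combination of centred words over the same indices and of the empty word,
  whose coefficient supplies the scalar \<open>c\<close>.\<close>

lemma block_decomposition:
  assumes "centrable l" "x \<in> block I"
  obtains c where "x - c *\<^sub>C 1 \<in> centred_span I l r"
proof -
  let ?V = "\<lambda>w. {v. (v = [] \<or> centred \<psi> \<theta> l v r) \<and> fst ` set v \<subseteq> fst ` set w}"
  have sub: "complex_algebra.subspace (centred_span I l r)" unfolding centred_span_def by simp
  have "\<exists>c. x - c *\<^sub>C 1 \<in> centred_span I l r"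
    using assms(2) unfolding block_def
  proof (induction rule: complex_algebra.span_induct_alt)
    case base
    show ?case by (rule exI[of _ 0]) (simp add: complex_algebra.subspace_0[OF sub])
  next
    case (step c u y)
    then obtain w where w: "fst ` set w \<subseteq> I" "u = word_prod id w" by blast
    have "\<exists>c. g id - c *\<^sub>C 1 \<in> centred_span I l r" if "g \<in> word_span (?V w)"
      for g :: "('i \<Rightarrow> 'i) \<Rightarrow> ('i, 'a) free_product"
      using that
    proof induction
      case (word v)
      show ?case
      proof (cases "v = []")
        case True
        then show ?thesis
          by (intro exI[of _ 1]) (simp add: complex_algebra.subspace_0[OF sub])
      next
        case False
        then have "word_prod id v \<in> centred_span I l r"
          using word w unfolding centred_span_def
          by (intro complex_algebra.span_base imageI) blast
        then show ?thesis by (intro exI[of _ 0]) (simp add: id_def)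
      qed
    next
      case zero
      show ?case by (rule exI[of _ 0]) (simp add: complex_algebra.subspace_0[OF sub])
    next
      case (add g h)
      then obtain c d where "g id - c *\<^sub>C 1 \<in> centred_span I l r" "h id - d *\<^sub>C 1 \<in> centred_span I l r"
        by blast
      from complex_algebra.subspace_add[OF sub this] show ?case
        by (intro exI[of _ "c + d"]) (simp add: complex_algebra.scale_left_distrib algebra_simps id_def)
    next
      case (scale g d)
      then obtain c where "g id - c *\<^sub>C 1 \<in> centred_span I l r" by blast
      from complex_algebra.subspace_scale[OF sub this] show ?case
        by (intro exI[of _ "d * c"]) (simp add: complex_algebra.scale_right_diff_distrib id_def)
    qed
    from this[OF word_prod_in_centred_span[OF assms(1) unital(1,2)]]
    obtain d where d: "u - d *\<^sub>C 1 \<in> centred_span I l r" using w(2) by blast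
    from step(2) obtain e where e: "y - e *\<^sub>C 1 \<in> centred_span I l r" by blast
    from complex_algebra.subspace_add[OF sub complex_algebra.subspace_scale[OF sub d, of c] e]
    show ?case
      by (intro exI[of _ "c * d + e"])
        (simp add: complex_algebra.scale_left_distrib complex_algebra.scale_right_diff_distrib algebra_simps)
  qed
  then show thesis using that by blast
qed

lemma functional_vanishes_on_span:
  assumes "u \<in> complex_algebra.span S" "\<And>x. x \<in> S \<Longrightarrow> outer b x = 0"
  shows "outer b u = 0"
  using assms(1) by (induction rule: complex_algebra.span_induct_alt) (use assms(2) in auto)

text \<open>
  Leading letters with an unconstrained monotone step are split into their expectation and a centred
  part; stripping them off leaves a word whose first letter is already centred by \<open>inner b\<close>.
\<close>

lemma outer_interior_centred:
  "centred \<psi> \<theta> (step_context \<psi> \<theta> b) w (Some (\<not> b)) \<Longrightarrow> outer b (word_prod id w) = 0"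
proof (induction w rule: induct_list012)
  case (2 p)
  then show ?case
    using outer_centred[of b "[p]" "Some (\<not> b)"] by (cases p) (auto simp: step_context_def inner_def)
next
  case (3 p q w)
  obtain i x j y where pq: "p = (i, x)" "q = (j, y)" by (cases p; cases q)
  show ?case
  proof (cases "(i < j) = b")
    case False
    then have "centred \<psi> \<theta> (\<lambda>_. inner b) (p # q # w) (Some (\<not> b))"
      using 3(3) by (auto simp: pq step_context_def inner_def split: if_splits)
    then show ?thesis by (rule outer_centred)
  next
    case True
    define c where "c = inner b x"
    have cen: "centred \<psi> \<theta> (step_context \<psi> \<theta> b) (q # w) (Some (\<not> b))"
      using 3(3) True by (simp add: pq)
    then have "outer b (word_prod id (q # w)) = 0"
      using 3(2) by (simp add: id_def)
    moreover have "centred \<psi> \<theta> (\<lambda>_. inner b) ((i, x - c *\<^sub>C 1) # q # w) (Some (\<not> b))"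
      using 3(3) by (simp add: pq c_def)
    then have "outer b (word_prod id ((i, x - c *\<^sub>C 1) # q # w)) = 0"
      by (rule outer_centred)
    moreover have "embed i (x - c *\<^sub>C 1) = embed i x - c *\<^sub>C 1"
      using embed_add[of i "x - c *\<^sub>C 1" "c *\<^sub>C 1"]
      by (simp add: embed_scaleC embed_one algebra_simps)
    ultimately show ?thesis
      by (simp add: pq left_diff_distrib mult_scaleC_left id_def)
  qed
qed simp

lemma block_minus_scalar_in_tails:
  assumes "x \<in> block I"
  obtains c where "x - c *\<^sub>C 1 \<in> tails I b"
proof -
  obtain c where "x - c *\<^sub>C 1 \<in> centred_span I (step_context \<psi> \<theta> b) None"
    using block_decomposition[OF centrable_step_context[OF unital(1,2)] assms] by blast
  moreover have "centred_span I (step_context \<psi> \<theta> b) None \<subseteq> tails I b"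
    unfolding centred_span_def tails_def
    by (intro complex_algebra.span_mono image_mono) (force dest: centred_nonempty)
  ultimately show thesis using that by blast
qed

text \<open>Centring the words of \<open>x\<close> leaves a scalar \<open>c\<close> over; applying
  \<open>outer b\<close>, which annihilates the centred words and \<open>x\<close>, forces
  \<open>c\<close> to be 0.\<close>

lemma interior_block_in_centred_span:
  assumes "x \<in> block I" "outer b x = 0"
  shows "x \<in> centred_span I (step_context \<psi> \<theta> b) (Some (\<not> b))"
proof -
  obtain c where c: "x - c *\<^sub>C 1 \<in> centred_span I (step_context \<psi> \<theta> b) (Some (\<not> b))"
    using block_decomposition[OF centrable_step_context[OF unital(1,2)] assms(1)] by blast
  then have "outer b (x - c *\<^sub>C 1) = 0"
    unfolding centred_span_def
    by (rule functional_vanishes_on_span) (auto intro: outer_interior_centred)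
  with c assms(2) show ?thesis by simp
qed

lemma interior_block_in_tails:
  assumes "x \<in> block I" "outer b x = 0"
  shows "x \<in> tails I b"
proof -
  have "centred_span I (step_context \<psi> \<theta> b) (Some (\<not> b)) \<subseteq> tails I b"
    unfolding centred_span_def tails_def
  proof (intro complex_algebra.span_mono image_mono subsetI CollectI conjI)
    fix w assume w: "w \<in> {w. centred \<psi> \<theta> (step_context \<psi> \<theta> b) w (Some (\<not> b)) \<and> fst ` set w \<subseteq> I}"
    then show "centred \<psi> \<theta> (step_context \<psi> \<theta> b) w None"
      by (auto intro!: centred_right_None simp: step_context_def)
    from w show "fst (hd w) \<in> I" using centred_nonempty by (cases w) auto
  qed
  with interior_block_in_centred_span[OF assms] show ?thesis by blast
qed

text \<open>By \<open>sep\<close> all of \<open>I\<close> lies on one side of \<open>J\<close>, so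
  the last letter of a word over \<open>I\<close> meets exactly the kind of right neighbour for
  which it was centred, and joining it with a tail gives a centred word.\<close>

lemma interior_block_mult_tails:
  assumes sep: "\<And>i j. i \<in> I \<Longrightarrow> j \<in> J \<Longrightarrow> i \<noteq> j \<and> (j < i) = b"
    and "x \<in> block I" "outer b x = 0" "t \<in> tails J (\<not> b)"
  shows "x * t \<in> tails I b"
proof (rule span_mult_induct)
  show "x \<in> complex_algebra.span (word_prod id `
      {w. centred \<psi> \<theta> (step_context \<psi> \<theta> b) w (Some (\<not> b)) \<and> fst ` set w \<subseteq> I})"
    using interior_block_in_centred_span[OF assms(2,3)] by (simp add: centred_span_def)
  show "t \<in> complex_algebra.span (word_prod id `
      {w. centred \<psi> \<theta> (step_context \<psi> \<theta> (\<not> b)) w None \<and> fst (hd w) \<in> J})"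
    using assms(4) by (simp add: tails_def)
  show "complex_algebra.subspace (tails I b)" by (simp add: tails_def)
  fix u s
  assume "u \<in> word_prod id ` {w. centred \<psi> \<theta> (step_context \<psi> \<theta> b) w (Some (\<not> b)) \<and> fst ` set w \<subseteq> I}"
    "s \<in> word_prod id ` {w. centred \<psi> \<theta> (step_context \<psi> \<theta> (\<not> b)) w None \<and> fst (hd w) \<in> J}"
  then obtain v w where v: "u = word_prod id v" "fst ` set v \<subseteq> I"
      "centred \<psi> \<theta> (step_context \<psi> \<theta> b) v (Some (\<not> b))"
    and w: "s = word_prod id w" "fst (hd w) \<in> J"
      "centred \<psi> \<theta> (step_context \<psi> \<theta> (\<not> b)) w None"
    by blast
  have ne: "v \<noteq> []" using v(3) centred_nonempty by blast
  then have "fst (last v) \<in> I" "fst (hd v) \<in> I"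
    using v(2) last_in_set hd_in_set by blast+
  then have "centred \<psi> \<theta> (step_context \<psi> \<theta> b) (v @ w) None"
    using sep[of "fst (last v)" "fst (hd w)"] w v
    by (intro centred_append[where b = "\<not> b"]) auto
  then show "u * s \<in> tails I b"
    unfolding tails_def v w word_prod_append[symmetric]
    by (intro complex_algebra.span_base imageI) (use ne \<open>fst (hd v) \<in> I\<close> in auto)
qed

text \<open>The same joining at the beginning of a word, where the first letter is centred by
  \<open>inner d\<close> whatever follows it.\<close>

lemma outer_block_mult_tails:
  assumes sep: "\<And>i j. i \<in> I \<Longrightarrow> j \<in> J \<Longrightarrow> i \<noteq> j \<and> (j < i) = b"
    and x: "x \<in> block I" "outer d x = 0" and t: "t \<in> tails J (\<not> b)"
  shows "outer d (x * t) = 0"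
proof -
  obtain c where c: "x - c *\<^sub>C 1 \<in> centred_span I (\<lambda>_. inner d) (Some (\<not> b))"
    using block_decomposition[OF centrable_const[OF unital_inner] x(1)] by blast
  then have "outer d (x - c *\<^sub>C 1) = 0"
    unfolding centred_span_def
    by (rule functional_vanishes_on_span) (auto intro: outer_centred)
  with c x(2) have x': "x \<in> centred_span I (\<lambda>_. inner d) (Some (\<not> b))" by simp
  have "x * t \<in> {u. outer d u = 0}"
  proof (rule span_mult_induct[OF x'[unfolded centred_span_def] t[unfolded tails_def]])
    show "complex_algebra.subspace {u. outer d u = 0}"
      by (auto simp: complex_algebra.subspace_def)
    fix u s
    assume "u \<in> word_prod id ` {w. centred \<psi> \<theta> (\<lambda>_. inner d) w (Some (\<not> b)) \<and> fst ` set w \<subseteq> I}"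
      "s \<in> word_prod id ` {w. centred \<psi> \<theta> (step_context \<psi> \<theta> (\<not> b)) w None \<and> fst (hd w) \<in> J}"
    then obtain v w where v: "u = word_prod id v" "fst ` set v \<subseteq> I"
        "centred \<psi> \<theta> (\<lambda>_. inner d) v (Some (\<not> b))"
      and w: "s = word_prod id w" "fst (hd w) \<in> J"
        "centred \<psi> \<theta> (step_context \<psi> \<theta> (\<not> b)) w None"
      by blast
    have "v \<noteq> []" using v(3) centred_nonempty by blast
    then have "fst (last v) \<in> I" using v(2) last_in_set by blast
    then have "centred \<psi> \<theta> (\<lambda>_. inner d) (v @ w) None"
      using sep[of "fst (last v)" "fst (hd w)"] w v
      by (intro centred_append[where b = "\<not> b"]) auto
    from outer_centred[OF this] show "u * s \<in> {u. outer d u = 0}" by (simp add: v w)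
  qed
  then show ?thesis by simp
qed

end

section \<open>First-order expansion in a small block\<close>

text \<open>Divisibility by the \<open>k\<close>-th power of the variable plays the role of a bound
  of order \<open>M^k\<close> as \<open>M\<close> tends to 0.\<close>

definition poly_order :: "nat \<Rightarrow> (nat \<Rightarrow> complex) set" where
  "poly_order k = {f. \<exists>p. \<forall>M. f M = of_nat M ^ k * poly p (of_nat M)}"

lemma poly_order_add: "f \<in> poly_order k \<Longrightarrow> g \<in> poly_order k \<Longrightarrow> (\<lambda>M. f M + g M) \<in> poly_order k"
  unfolding poly_order_def by (auto simp flip: distrib_left poly_add)

lemma poly_order_mult:
  "f \<in> poly_order j \<Longrightarrow> g \<in> poly_order k \<Longrightarrow> (\<lambda>M. f M * g M) \<in> poly_order (j + k)"
proof -
  assume "f \<in> poly_order j" "g \<in> poly_order k"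
  then obtain p q where "\<And>M. f M = of_nat M ^ j * poly p (of_nat M)"
    "\<And>M. g M = of_nat M ^ k * poly q (of_nat M)"
    unfolding poly_order_def by blast
  then have "f M * g M = of_nat M ^ (j + k) * poly (p * q) (of_nat M)" for M
    by (simp add: power_add)
  then show ?thesis unfolding poly_order_def by blast
qed

lemma poly_order_const: "(\<lambda>M. c) \<in> poly_order 0"
  unfolding poly_order_def by (auto intro: exI[of _ "[:c:]"])

lemma poly_order_zero: "(\<lambda>M. 0) \<in> poly_order k"
  unfolding poly_order_def by (auto intro: exI[of _ 0])

lemma poly_order_cmult: "f \<in> poly_order k \<Longrightarrow> (\<lambda>M. c * f M) \<in> poly_order k"
  using poly_order_mult[OF poly_order_const[of c], of f k] by simp

lemma poly_order_uminus: "f \<in> poly_order k \<Longrightarrow> (\<lambda>M. - f M) \<in> poly_order k"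
  using poly_order_cmult[of f k "-1"] by simp

lemma poly_order_mono:
  assumes "f \<in> poly_order k" "j \<le> k" shows "f \<in> poly_order j"
proof -
  obtain p where "\<And>M. f M = of_nat M ^ k * poly p (of_nat M)"
    using assms(1) unfolding poly_order_def by blast
  then have "f M = of_nat M ^ j * poly (monom 1 (k - j) * p) (of_nat M)" for M
    using assms(2) by (simp add: poly_monom mult.assoc flip: power_add)
  then show ?thesis unfolding poly_order_def by blast
qed

text \<open>The order \<open>k\<close> is required of the scalar term only. If all positive powers
  of \<open>x\<close> have moments of order \<open>k\<close>, so do all members, and centring by
  such moments stays in the family.\<close>

inductive_set poly_family :: "nat \<Rightarrow> (nat \<Rightarrow> 'u::complex_algebra_1) \<Rightarrow> (nat \<Rightarrow> 'u) set" for k x where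
  const: "c \<in> poly_order k \<Longrightarrow> (\<lambda>M. c M *\<^sub>C 1) \<in> poly_family k x"
| power: "c \<in> poly_order 0 \<Longrightarrow> (\<lambda>M. c M *\<^sub>C x M ^ Suc n) \<in> poly_family k x"
| add: "u \<in> poly_family k x \<Longrightarrow> v \<in> poly_family k x \<Longrightarrow> (\<lambda>M. u M + v M) \<in> poly_family k x"

lemma poly_family_scale:
  assumes "u \<in> poly_family k x" "c \<in> poly_order 0"
  shows "(\<lambda>M. c M *\<^sub>C u M) \<in> poly_family k x"
  using assms(1)
proof induction
  case (const d)
  then show ?case
    using poly_family.const[OF poly_order_mult[OF assms(2) const, simplified]] by simp
next
  case (power d n)
  then show ?case
    using poly_family.power[OF poly_order_mult[OF assms(2) power, simplified]] by simp
next
  case (add u v)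
  then show ?case by (simp add: scaleC_add_right poly_family.add)
qed

lemma poly_family_mult_power:
  assumes "u \<in> poly_family k x" shows "(\<lambda>M. x M ^ Suc n * u M) \<in> poly_family k x"
  using assms
proof induction
  case (const c)
  then have "c \<in> poly_order 0" by (rule poly_order_mono) simp
  from poly_family.power[OF this, of x n] show ?case by (simp add: mult_scaleC_right)
next
  case (power c m)
  from poly_family.power[OF power, of x "Suc (n + m)"] show ?case
    by (simp add: mult_scaleC_right flip: power_add power_Suc)
next
  case (add u v)
  then show ?case by (simp add: distrib_left poly_family.add)
qed

lemma poly_family_mult:
  assumes "u \<in> poly_family k x" "v \<in> poly_family k x"
  shows "(\<lambda>M. u M * v M) \<in> poly_family k x"
  using assms(1)
proof induction
  case (const c)
  from poly_family_scale[OF assms(2) poly_order_mono[OF const]] show ?case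
    by (simp add: mult_scaleC_left)
next
  case (power c n)
  from poly_family_scale[OF poly_family_mult_power[OF assms(2), of n] power] show ?case
    by (simp add: mult_scaleC_left)
next
  case (add u v)
  then show ?case by (simp add: distrib_right poly_family.add)
qed

lemma poly_family_one: "(\<lambda>M. 1) \<in> poly_family 0 x"
  using poly_family.const[OF poly_order_const[of 1], of x] by simp

lemma poly_family_self: "x \<in> poly_family k x"
  using poly_family.power[OF poly_order_const[of 1], of x 0 k] by simp

lemma poly_family_power_Suc: "(\<lambda>M. x M ^ Suc n) \<in> poly_family k x"
  using poly_family.power[OF poly_order_const[of 1], of x n k] by simp

lemma poly_family_power: "(\<lambda>M. x M ^ n) \<in> poly_family 0 x"
  using poly_family_power_Suc[of x "n - 1" 0] poly_family_one[of x] by (cases n) auto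

lemma poly_family_centred:
  assumes "u \<in> poly_family k x" "c \<in> poly_order k"
  shows "(\<lambda>M. u M - c M *\<^sub>C 1) \<in> poly_family k x"
  using poly_family.add[OF assms(1) poly_family.const[OF poly_order_uminus[OF assms(2)]]] by simp

lemma (in unital_functional) poly_family_moment:
  assumes "u \<in> poly_family k x" "\<And>n. (\<lambda>M. f (x M ^ Suc n)) \<in> poly_order k"
  shows "(\<lambda>M. f (u M)) \<in> poly_order k"
  using assms(1)
proof induction
  case (power c n)
  from poly_order_mult[OF power assms(2)[of n]] show ?case by simp
qed (auto intro: poly_order_add)

text \<open>Pairing each small-block letter with the large-block letter after it makes the length of
  the list the number of small-block letters, on which the inductions below run.\<close>

fun pair_word :: "((nat \<Rightarrow> 'u) \<times> (nat \<Rightarrow> 'u)) list \<Rightarrow> nat \<Rightarrow> 'u::complex_algebra_1" where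
  "pair_word [] M = 1"
| "pair_word ((y, x) # zs) M = y M * x M * pair_word zs M"

lemma pair_word_append [simp]: "pair_word (ys @ zs) M = pair_word ys M * pair_word zs M"
  by (induction ys) (auto simp: mult.assoc)

text \<open>
  \<open>A1 M\<close> and \<open>A2 M\<close> are the algebras generated by the large and the small block, with interior
  centring functionals \<open>\<sigma>\<close> and \<open>\<tau>\<close>; \<open>T1 M\<close> and \<open>T2 M\<close> are the spans of the centred words that begin in
  the respective block and may be appended to a centred element of the other one.
\<close>

locale block_family =
  F: unital_functional F + \<sigma>: unital_functional \<sigma> + \<tau>: unital_functional \<tau>
  for F \<sigma> \<tau> :: "'u::complex_algebra_1 \<Rightarrow> complex" +
  fixes A1 A2 T1 T2 :: "nat \<Rightarrow> 'u set"
    and x y :: "nat \<Rightarrow> 'u"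
    and s m :: "nat \<Rightarrow> complex"
  assumes A1_one: "1 \<in> A1 M" and A2_one: "1 \<in> A2 M"
    and A1_add: "a \<in> A1 M \<Longrightarrow> b \<in> A1 M \<Longrightarrow> a + b \<in> A1 M"
    and A2_add: "a \<in> A2 M \<Longrightarrow> b \<in> A2 M \<Longrightarrow> a + b \<in> A2 M"
    and A1_scaleC: "a \<in> A1 M \<Longrightarrow> c *\<^sub>C a \<in> A1 M"
    and A2_scaleC: "a \<in> A2 M \<Longrightarrow> c *\<^sub>C a \<in> A2 M"
    and A1_mult: "a \<in> A1 M \<Longrightarrow> b \<in> A1 M \<Longrightarrow> a * b \<in> A1 M"
    and A2_mult: "a \<in> A2 M \<Longrightarrow> b \<in> A2 M \<Longrightarrow> a * b \<in> A2 M"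
    and x_in: "x M \<in> A1 M" and y_in: "y M \<in> A2 M"
    and T1_decomp: "a \<in> A1 M \<Longrightarrow> \<exists>c. a - c *\<^sub>C 1 \<in> T1 M"
    and T1_interior: "a \<in> A1 M \<Longrightarrow> \<sigma> a = 0 \<Longrightarrow> a \<in> T1 M"
    and T2_interior: "b \<in> A2 M \<Longrightarrow> \<tau> b = 0 \<Longrightarrow> b \<in> T2 M"
    and T1_mult: "a \<in> A1 M \<Longrightarrow> \<sigma> a = 0 \<Longrightarrow> t \<in> T2 M \<Longrightarrow> a * t \<in> T1 M"
    and T2_mult: "b \<in> A2 M \<Longrightarrow> \<tau> b = 0 \<Longrightarrow> t \<in> T1 M \<Longrightarrow> b * t \<in> T2 M"
    and F_T2: "a \<in> A1 M \<Longrightarrow> F a = 0 \<Longrightarrow> t \<in> T2 M \<Longrightarrow> F (a * t) = 0"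
    and F_T1: "b \<in> A2 M \<Longrightarrow> F b = 0 \<Longrightarrow> t \<in> T1 M \<Longrightarrow> F (b * t) = 0"
    and \<sigma>_x: "\<sigma> (x M ^ n) = s n" and F_x: "F (x M ^ n) = m n"
    and \<tau>_y: "(\<lambda>M. \<tau> (y M ^ Suc n)) \<in> poly_order (Suc 0)"
    and F_y: "(\<lambda>M. F (y M ^ Suc n)) \<in> poly_order (Suc 0)"
begin

abbreviation "X \<equiv> poly_family 0 x"
abbreviation "Y \<equiv> poly_family (Suc 0) y"

lemma X_in: "u \<in> X \<Longrightarrow> u M \<in> A1 M"
proof (induction rule: poly_family.induct)
  case (power c n)
  have "x M ^ n \<in> A1 M" for n by (induction n) (auto intro: A1_one A1_mult x_in)
  then show ?case by (rule A1_scaleC)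
qed (auto intro: A1_one A1_scaleC A1_add)

lemma Y_in: "u \<in> Y \<Longrightarrow> u M \<in> A2 M"
proof (induction rule: poly_family.induct)
  case (power c n)
  have "y M ^ n \<in> A2 M" for n by (induction n) (auto intro: A2_one A2_mult y_in)
  then show ?case by (rule A2_scaleC)
qed (auto intro: A2_one A2_scaleC A2_add)

lemma X_moments: "u \<in> X \<Longrightarrow> (\<lambda>M. \<sigma> (u M)) \<in> poly_order 0" "u \<in> X \<Longrightarrow> (\<lambda>M. F (u M)) \<in> poly_order 0"
  using \<sigma>.poly_family_moment[of u 0 x] F.poly_family_moment[of u 0 x]
  by (simp_all only: \<sigma>_x F_x poly_order_const)

lemma Y_moments: "u \<in> Y \<Longrightarrow> (\<lambda>M. \<tau> (u M)) \<in> poly_order (Suc 0)" "u \<in> Y \<Longrightarrow> (\<lambda>M. F (u M)) \<in> poly_order (Suc 0)"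
  using \<tau>.poly_family_moment[OF _ \<tau>_y] F.poly_family_moment[OF _ F_y] by blast+

lemma X_centred: "u \<in> X \<Longrightarrow> (\<lambda>M. u M - \<sigma> (u M) *\<^sub>C 1) \<in> X" "u \<in> X \<Longrightarrow> (\<lambda>M. u M - F (u M) *\<^sub>C 1) \<in> X"
  using poly_family_centred X_moments by blast+

lemma Y_centred: "u \<in> Y \<Longrightarrow> (\<lambda>M. u M - \<tau> (u M) *\<^sub>C 1) \<in> Y" "u \<in> Y \<Longrightarrow> (\<lambda>M. u M - F (u M) *\<^sub>C 1) \<in> Y"
  using poly_family_centred Y_moments by blast+

text \<open>
  Left factors that \<open>F\<close> annihilates when a tail of the other block is appended. Starting from these,
  the letters of a word are centred one by one from the left.
\<close>

definition left1 :: "(nat \<Rightarrow> 'u) set" where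
  "left1 = {g. \<forall>M. F (g M) = 0 \<and> (\<forall>t\<in>T2 M. F (g M * t) = 0)}"

definition left2 :: "(nat \<Rightarrow> 'u) set" where
  "left2 = {g. \<forall>M. F (g M) = 0 \<and> (\<forall>t\<in>T1 M. F (g M * t) = 0)}"

lemma left1_start: "u \<in> X \<Longrightarrow> (\<lambda>M. u M - F (u M) *\<^sub>C 1) \<in> left1"
  using X_in[OF X_centred(2)] by (auto simp: left1_def intro!: F_T2)

lemma left2_start: "u \<in> Y \<Longrightarrow> (\<lambda>M. u M - F (u M) *\<^sub>C 1) \<in> left2"
  using Y_in[OF Y_centred(2)] by (auto simp: left2_def intro!: F_T1)

lemma left1_step:
  assumes "g \<in> left2" "u \<in> X" shows "(\<lambda>M. g M * (u M - \<sigma> (u M) *\<^sub>C 1)) \<in> left1"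
proof -
  have a: "u M - \<sigma> (u M) *\<^sub>C 1 \<in> A1 M" "\<sigma> (u M - \<sigma> (u M) *\<^sub>C 1) = 0" for M
    using X_in[OF X_centred(1)[OF assms(2)]] by auto
  show ?thesis
    using T1_interior[OF a] T1_mult[OF a] assms(1) by (auto simp: left1_def left2_def mult.assoc)
qed

lemma left2_step:
  assumes "g \<in> left1" "u \<in> Y" shows "(\<lambda>M. g M * (u M - \<tau> (u M) *\<^sub>C 1)) \<in> left2"
proof -
  have a: "u M - \<tau> (u M) *\<^sub>C 1 \<in> A2 M" "\<tau> (u M - \<tau> (u M) *\<^sub>C 1) = 0" for M
    using Y_in[OF Y_centred(1)[OF assms(2)]] by auto
  show ?thesis
    using T2_interior[OF a] T2_mult[OF a] assms(1) by (auto simp: left1_def left2_def mult.assoc)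
qed

text \<open>A final large-block letter needs no exact centring: the scalar left over by
  \<open>T1_decomp\<close> multiplies \<open>F (g M)\<close>, which is 0.\<close>

lemma left2_X:
  assumes "g \<in> left2" "u \<in> X" shows "F (g M * u M) = 0"
proof -
  obtain c where "u M - c *\<^sub>C 1 \<in> T1 M" using T1_decomp[OF X_in[OF assms(2)]] by blast
  then have "F (g M * (u M - c *\<^sub>C 1)) = 0" "F (g M) = 0" using assms(1) by (auto simp: left2_def)
  then show ?thesis by (simp add: right_diff_distrib mult_scaleC_right)
qed

text \<open>A large-block letter multiplied on the right is absorbed by the last pair or, in its
  absence, by the leading factor, so the number of pairs is kept.\<close>

lemma word_snoc_X:
  assumes "u \<in> X" "v \<in> X" "set zs \<subseteq> Y \<times> X"
  obtains u' zs' where "u' \<in> X" "set zs' \<subseteq> Y \<times> X" "length zs' = length zs"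
    "\<And>M. u' M * pair_word zs' M = u M * pair_word zs M * v M"
proof (cases zs rule: rev_cases)
  case Nil
  then show thesis
    using that[of "\<lambda>M. u M * v M" "[]"] poly_family_mult[OF assms(1,2)] by simp
next
  case (snoc ys z)
  obtain b a where z: "z = (b, a)" by (cases z)
  show thesis
    by (rule that[of u "ys @ [(b, \<lambda>M. a M * v M)]"])
      (use assms snoc z in \<open>auto simp: mult.assoc intro: poly_family_mult\<close>)
qed

lemma expand_Y: "F (g * u * t) = \<tau> u * F (g * t) + F (g * (u - \<tau> u *\<^sub>C 1) * t)"
  by (simp add: right_diff_distrib left_diff_distrib mult_scaleC_right mult_scaleC_left)

lemma expand_X: "F (g * u * t) = \<sigma> u * F (g * t) + F (g * (u - \<sigma> u *\<^sub>C 1) * t)"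
  by (simp add: right_diff_distrib left_diff_distrib mult_scaleC_right mult_scaleC_left)

lemma expand_F: "F (u * t) = F u * F t + F ((u - F u *\<^sub>C 1) * t)"
  by (simp add: left_diff_distrib mult_scaleC_left)

text \<open>
  Here \<open>u\<close>, \<open>ds\<close> is the part of the word that is centred already. Each step either replaces a letter by
  its expectation, which merges its neighbours into a shorter word, or enlarges the centred part.
\<close>

lemma word_order_1_aux:
  assumes IH: "\<And>u zs. u \<in> X \<Longrightarrow> set zs \<subseteq> Y \<times> X \<Longrightarrow> length zs < n \<Longrightarrow>
      (\<lambda>M. F (u M * pair_word zs M)) \<in> poly_order (if zs = [] then 0 else Suc 0)"
    and "u \<in> X" "set ds \<subseteq> Y \<times> X" "set zs \<subseteq> Y \<times> X" "length ds + length zs = n"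
    and "(\<lambda>M. u M * pair_word ds M) \<in> left1"
  shows "(\<lambda>M. F (u M * pair_word ds M * pair_word zs M)) \<in> poly_order (Suc 0)"
  using assms(3-)
proof (induction zs arbitrary: ds)
  case Nil
  then show ?case by (auto simp: left1_def poly_order_zero)
next
  case (Cons z zs)
  obtain b a where z: "z = (b, a)" "b \<in> Y" "a \<in> X" using Cons.prems by (cases z) auto
  let ?b = "\<lambda>M. b M - \<tau> (b M) *\<^sub>C 1" and ?a = "\<lambda>M. a M - \<sigma> (a M) *\<^sub>C 1"
  let ?g = "\<lambda>M. u M * pair_word ds M"
  have zs: "set zs \<subseteq> Y \<times> X" using Cons.prems by simp
  obtain u' ds' where ds': "u' \<in> X" "set ds' \<subseteq> Y \<times> X" "length ds' = length ds"
    "\<And>M. u' M * pair_word ds' M = ?g M * a M"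
    using word_snoc_X[OF assms(2) z(3) Cons.prems(1)] by blast
  \<comment> \<open>The scalar \<open>\<tau> (b M)\<close> already supplies order 1, so order 0
    suffices for the shortened word.\<close>
  have "(\<lambda>M. F (?g M * (a M * pair_word zs M))) \<in> poly_order 0"
  proof -
    have "(\<lambda>M. F (u' M * pair_word (ds' @ zs) M)) \<in> poly_order (if ds' @ zs = [] then 0 else Suc 0)"
      by (rule IH) (use ds' zs Cons.prems in auto)
    then have "(\<lambda>M. F (u' M * pair_word (ds' @ zs) M)) \<in> poly_order 0"
      by (rule poly_order_mono) simp
    then show ?thesis by (simp add: ds'(4) flip: mult.assoc)
  qed
  from poly_order_mult[OF Y_moments(1)[OF z(2)] this]
  have 1: "(\<lambda>M. \<tau> (b M) * F (?g M * (a M * pair_word zs M))) \<in> poly_order (Suc 0)" by simp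
  have left2: "(\<lambda>M. ?g M * ?b M) \<in> left2" by (rule left2_step) (use Cons.prems z in auto)
  have 2: "(\<lambda>M. F (?g M * ?b M * (a M * pair_word zs M))) \<in> poly_order (Suc 0)"
  proof (cases zs)
    case Nil
    then show ?thesis using left2_X[OF left2 z(3)] by (simp add: poly_order_zero)
  next
    case (Cons z' zs')
    obtain b' a' where z': "z' = (b', a')" "b' \<in> Y" "a' \<in> X" using Cons zs by (cases z') auto
    have "(\<lambda>M. F (u M * pair_word (ds @ (\<lambda>M. ?b M * b' M, a') # zs') M)) \<in> poly_order
        (if ds @ (\<lambda>M. ?b M * b' M, a') # zs' = [] then 0 else Suc 0)"
      by (rule IH)
        (use assms(2) z z' zs Cons Cons.prems in \<open>auto intro!: poly_family_mult Y_centred\<close>)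
    then have "(\<lambda>M. F (?g M * ?b M * pair_word zs M)) \<in> poly_order (Suc 0)"
      by (simp add: Cons z' mult.assoc)
    from poly_order_mult[OF X_moments(1)[OF z(3)] this]
    have 3: "(\<lambda>M. \<sigma> (a M) * F (?g M * ?b M * pair_word zs M)) \<in> poly_order (Suc 0)" by simp
    have "(\<lambda>M. F (u M * pair_word (ds @ [(?b, ?a)]) M * pair_word zs M)) \<in> poly_order (Suc 0)"
      by (rule Cons.IH)
        (use Cons.prems z left1_step[OF left2 z(3)] in \<open>auto intro!: Y_centred X_centred simp: mult.assoc\<close>)
    then have 4: "(\<lambda>M. F (?g M * ?b M * ?a M * pair_word zs M)) \<in> poly_order (Suc 0)"
      by (simp add: mult.assoc)
    have e: "F (?g M * ?b M * (a M * pair_word zs M)) =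
        \<sigma> (a M) * F (?g M * ?b M * pair_word zs M) + F (?g M * ?b M * ?a M * pair_word zs M)" for M
      using expand_X[of "?g M * ?b M" "a M" "pair_word zs M"] by (simp only: mult.assoc)
    show ?thesis unfolding e by (rule poly_order_add[OF 3 4])
  qed
  have e: "F (?g M * pair_word (z # zs) M) =
      \<tau> (b M) * F (?g M * (a M * pair_word zs M)) + F (?g M * ?b M * (a M * pair_word zs M))" for M
    using expand_Y[of "?g M" "b M" "a M * pair_word zs M"] by (simp only: z pair_word.simps mult.assoc)
  show ?case unfolding e by (rule poly_order_add[OF 1 2])
qed

text \<open>Replacing a small-block letter by its expectation costs a factor of order 1, and a fully
  centred word has expectation 0. At the start of the word \<open>F\<close> itself does the
  centring; prefixes in \<open>left1\<close> are left to \<open>word_order_1_aux\<close>.\<close>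

lemma word_order_1:
  assumes "u \<in> X" "set zs \<subseteq> Y \<times> X"
  shows "(\<lambda>M. F (u M * pair_word zs M)) \<in> poly_order (if zs = [] then 0 else Suc 0)"
  using assms
proof (induction "length zs" arbitrary: u zs rule: less_induct)
  case less
  note IH = less.hyps
  show ?case
  proof (cases zs)
    case Nil
    then show ?thesis using X_moments(2)[OF less.prems(1)] by simp
  next
    case (Cons z zs')
    obtain b a where z: "z = (b, a)" "b \<in> Y" "a \<in> X" using less.prems Cons by (cases z) auto
    have zs': "set zs' \<subseteq> Y \<times> X" using less.prems Cons by simp
    let ?u = "\<lambda>M. u M - F (u M) *\<^sub>C 1" and ?b = "\<lambda>M. b M - F (b M) *\<^sub>C 1"
      and ?a = "\<lambda>M. a M - \<sigma> (a M) *\<^sub>C 1"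
    have aux: "(\<lambda>M. F (u M * pair_word ds M * pair_word ws M)) \<in> poly_order (Suc 0)"
      if "u \<in> X" "set ds \<subseteq> Y \<times> X" "set ws \<subseteq> Y \<times> X" "length ds + length ws = length zs"
        "(\<lambda>M. u M * pair_word ds M) \<in> left1" for u ds ws
      by (rule word_order_1_aux[OF _ that(1-5)]) (rule IH)
    have 1: "(\<lambda>M. F (?u M * pair_word zs M)) \<in> poly_order (Suc 0)"
      using aux[of ?u "[]" zs] less.prems left1_start X_centred by simp
    have "(\<lambda>M. F (a M * pair_word zs' M)) \<in> poly_order (if zs' = [] then 0 else Suc 0)"
      by (rule IH) (use Cons z zs' in auto)
    then have "(\<lambda>M. F (a M * pair_word zs' M)) \<in> poly_order 0" by (rule poly_order_mono) simp
    from poly_order_mult[OF Y_moments(2)[OF z(2)] this]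
    have 2: "(\<lambda>M. F (b M) * F (a M * pair_word zs' M)) \<in> poly_order (Suc 0)" by simp
    have left2: "?b \<in> left2" by (rule left2_start[OF z(2)])
    have 3: "(\<lambda>M. F (?b M * (a M * pair_word zs' M))) \<in> poly_order (Suc 0)"
    proof (cases zs')
      case Nil
      then show ?thesis using left2_X[OF left2 z(3)] by (simp add: poly_order_zero)
    next
      case (Cons z' ws)
      obtain b' a' where z': "z' = (b', a')" "b' \<in> Y" "a' \<in> X" using Cons zs' by (cases z') auto
      have "(\<lambda>M. F ((\<lambda>M. 1) M * pair_word ((\<lambda>M. ?b M * b' M, a') # ws) M)) \<in> poly_order
          (if (\<lambda>M. ?b M * b' M, a') # ws = [] then 0 else Suc 0)"
        by (rule IH)
          (use \<open>zs = z # zs'\<close> Cons z z' zs' in \<open>auto intro!: poly_family_mult Y_centred poly_family_one\<close>)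
      then have "(\<lambda>M. F (?b M * pair_word zs' M)) \<in> poly_order (Suc 0)"
        by (simp add: Cons z' mult.assoc)
      from poly_order_mult[OF X_moments(1)[OF z(3)] this]
      have 4: "(\<lambda>M. \<sigma> (a M) * F (?b M * pair_word zs' M)) \<in> poly_order (Suc 0)" by simp
      have "(\<lambda>M. F ((\<lambda>M. 1) M * pair_word [(?b, ?a)] M * pair_word zs' M)) \<in> poly_order (Suc 0)"
        by (rule aux)
          (use \<open>zs = z # zs'\<close> z zs' left1_step[OF left2 z(3)] in
            \<open>auto intro!: Y_centred X_centred poly_family_one simp: mult.assoc\<close>)
      then have 5: "(\<lambda>M. F (?b M * ?a M * pair_word zs' M)) \<in> poly_order (Suc 0)" by simp
      have e: "F (?b M * (a M * pair_word zs' M)) =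
          \<sigma> (a M) * F (?b M * pair_word zs' M) + F (?b M * ?a M * pair_word zs' M)" for M
        using expand_X[of "?b M" "a M" "pair_word zs' M"] by (simp only: mult.assoc)
      show ?thesis unfolding e by (rule poly_order_add[OF 4 5])
    qed
    have "F (pair_word zs M) = F (b M) * F (a M * pair_word zs' M) + F (?b M * (a M * pair_word zs' M))" for M
      using expand_F[of "b M" "a M * pair_word zs' M"] by (simp only: Cons z pair_word.simps mult.assoc)
    then have "(\<lambda>M. F (pair_word zs M)) \<in> poly_order (Suc 0)"
      using poly_order_add[OF 2 3] by simp
    from poly_order_mult[OF X_moments(2)[OF less.prems(1)] this]
    have 6: "(\<lambda>M. F (u M) * F (pair_word zs M)) \<in> poly_order (Suc 0)" by simp
    have "(\<lambda>M. F (u M * pair_word zs M)) \<in> poly_order (Suc 0)"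
      by (subst expand_F) (rule poly_order_add[OF 6 1])
    then show ?thesis using Cons by simp
  qed
qed

text \<open>Replacing a small-block letter of \<open>zs\<close> by its expectation gives one factor
  of order 1; the shortened word still contains a small-block letter from \<open>ds\<close> and
  gives a second. Where no such letter is replaced, centring continues until the word
  vanishes.\<close>

lemma word_order_2_aux:
  assumes "u \<in> X" "set ds \<subseteq> Y \<times> X" "set zs \<subseteq> Y \<times> X" "ds \<noteq> []" "zs \<noteq> []"
    and "(\<lambda>M. u M * pair_word ds M) \<in> left1"
  shows "(\<lambda>M. F (u M * pair_word ds M * pair_word zs M)) \<in> poly_order 2"
  using assms(2-)
proof (induction "length zs" arbitrary: ds zs rule: less_induct)
  case less
  obtain b a zs' where z: "zs = (b, a) # zs'" "b \<in> Y" "a \<in> X"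
    using less.prems by (cases zs) auto
  let ?b = "\<lambda>M. b M - \<tau> (b M) *\<^sub>C 1" and ?a = "\<lambda>M. a M - \<sigma> (a M) *\<^sub>C 1"
  let ?g = "\<lambda>M. u M * pair_word ds M"
  have zs': "set zs' \<subseteq> Y \<times> X" using less.prems z by simp
  obtain u' ds' where ds': "u' \<in> X" "set ds' \<subseteq> Y \<times> X" "length ds' = length ds"
    "\<And>M. u' M * pair_word ds' M = ?g M * a M"
    using word_snoc_X[OF assms(1) z(3) less.prems(1)] by blast
  have "(\<lambda>M. F (?g M * (a M * pair_word zs' M))) \<in> poly_order (Suc 0)"
  proof -
    have "(\<lambda>M. F (u' M * pair_word (ds' @ zs') M)) \<in> poly_order (if ds' @ zs' = [] then 0 else Suc 0)"
      by (rule word_order_1) (use ds' zs' in auto)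
    moreover have "ds' @ zs' \<noteq> []" using ds'(3) less.prems(3) by auto
    ultimately have "(\<lambda>M. F (u' M * pair_word (ds' @ zs') M)) \<in> poly_order (Suc 0)"
      by (simp only: if_False)
    then show ?thesis by (simp add: ds'(4) flip: mult.assoc)
  qed
  from poly_order_mult[OF Y_moments(1)[OF z(2)] this]
  have 1: "(\<lambda>M. \<tau> (b M) * F (?g M * (a M * pair_word zs' M))) \<in> poly_order 2"
    by (simp add: numeral_2_eq_2)
  have left2: "(\<lambda>M. ?g M * ?b M) \<in> left2" by (rule left2_step) (use less.prems z in auto)
  have 2: "(\<lambda>M. F (?g M * ?b M * (a M * pair_word zs' M))) \<in> poly_order 2"
  proof (cases zs')
    case Nil
    then show ?thesis using left2_X[OF left2 z(3)] by (simp add: poly_order_zero)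
  next
    case (Cons z' ws)
    obtain b' a' where z': "z' = (b', a')" "b' \<in> Y" "a' \<in> X" using Cons zs' by (cases z') auto
    have "(\<lambda>M. F (?g M * pair_word ((\<lambda>M. ?b M * b' M, a') # ws) M)) \<in> poly_order 2"
      by (rule less.hyps)
        (use less.prems z z' zs' Cons in \<open>auto intro!: poly_family_mult Y_centred\<close>)
    then have "(\<lambda>M. F (?g M * ?b M * pair_word zs' M)) \<in> poly_order 2"
      by (simp add: Cons z' mult.assoc)
    from poly_order_mult[OF X_moments(1)[OF z(3)] this]
    have 3: "(\<lambda>M. \<sigma> (a M) * F (?g M * ?b M * pair_word zs' M)) \<in> poly_order 2"
      by (simp only: add_0)
    have "(\<lambda>M. F (u M * pair_word (ds @ [(?b, ?a)]) M * pair_word zs' M)) \<in> poly_order 2"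
      by (rule less.hyps)
        (use less.prems z Cons zs' left1_step[OF left2 z(3)] in \<open>auto intro!: Y_centred X_centred simp: mult.assoc\<close>)
    then have 4: "(\<lambda>M. F (?g M * ?b M * ?a M * pair_word zs' M)) \<in> poly_order 2"
      by (simp add: mult.assoc)
    have e: "F (?g M * ?b M * (a M * pair_word zs' M)) =
        \<sigma> (a M) * F (?g M * ?b M * pair_word zs' M) + F (?g M * ?b M * ?a M * pair_word zs' M)" for M
      using expand_X[of "?g M * ?b M" "a M" "pair_word zs' M"] by (simp only: mult.assoc)
    show ?thesis unfolding e by (rule poly_order_add[OF 3 4])
  qed
  have e: "F (?g M * pair_word zs M) =
      \<tau> (b M) * F (?g M * (a M * pair_word zs' M)) + F (?g M * ?b M * (a M * pair_word zs' M))" for M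
    using expand_Y[of "?g M" "b M" "a M * pair_word zs' M"] by (simp only: z pair_word.simps mult.assoc)
  show ?case unfolding e by (rule poly_order_add[OF 1 2])
qed

text \<open>This is why a large-block factor between two small-block ones may be replaced by its
  interior expectation. Centring \<open>u\<close> and \<open>b\<close> leaves terms that either have
  two factors of order 1 or fall under \<open>word_order_2_aux\<close>.\<close>

lemma word_order_2:
  assumes "u \<in> X" "b \<in> Y" "a \<in> X" "set zs \<subseteq> Y \<times> X" "zs \<noteq> []"
  shows "(\<lambda>M. F (u M * b M * (a M - \<sigma> (a M) *\<^sub>C 1) * pair_word zs M)) \<in> poly_order 2"
proof -
  let ?u = "\<lambda>M. u M - F (u M) *\<^sub>C 1" and ?a = "\<lambda>M. a M - \<sigma> (a M) *\<^sub>C 1"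
    and ?b = "\<lambda>M. b M - \<tau> (b M) *\<^sub>C 1" and ?b' = "\<lambda>M. b M - F (b M) *\<^sub>C 1"
  let ?t = "\<lambda>M. ?a M * pair_word zs M"
  have aX: "?a \<in> X" by (rule X_centred[OF assms(3)])
  have 1: "(\<lambda>M. F (?t M)) \<in> poly_order (Suc 0)"
    using word_order_1[OF aX assms(4)] assms(5) by simp
  have 2: "(\<lambda>M. F (?u M * ?t M)) \<in> poly_order (Suc 0)"
    using word_order_1[OF poly_family_mult[OF X_centred(2)[OF assms(1)] aX] assms(4)] assms(5)
    by (simp add: mult.assoc)
  have 3: "(\<lambda>M. F (?b' M * ?t M)) \<in> poly_order 2"
    using word_order_2_aux[of "\<lambda>M. 1" "[(?b', ?a)]" zs] assms aX Y_centred(2)[OF assms(2)]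
      left1_step[OF left2_start[OF assms(2)] assms(3)]
    by (simp add: poly_family_one mult.assoc)
  have 4: "(\<lambda>M. F (?u M * ?b M * ?t M)) \<in> poly_order 2"
    using word_order_2_aux[of ?u "[(?b, ?a)]" zs] assms aX Y_centred(1)[OF assms(2)] X_centred(2)[OF assms(1)]
      left1_step[OF left2_step[OF left1_start[OF assms(1)] assms(2)] assms(3)]
    by (simp add: mult.assoc)
  have 5: "(\<lambda>M. F (u M) * (F (b M) * F (?t M) + F (?b' M * ?t M))) \<in> poly_order 2"
    using poly_order_mult[OF X_moments(2)[OF assms(1)]
        poly_order_add[OF poly_order_mult[OF Y_moments(2)[OF assms(2)] 1, simplified add_Suc add_0 numeral_2_eq_2[symmetric]] 3]]
    by (simp only: add_0)
  have 6: "(\<lambda>M. \<tau> (b M) * F (?u M * ?t M) + F (?u M * ?b M * ?t M)) \<in> poly_order 2"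
    using poly_order_add[OF poly_order_mult[OF Y_moments(1)[OF assms(2)] 2, simplified add_Suc add_0 numeral_2_eq_2[symmetric]] 4] .
  have "F (u M * b M * ?a M * pair_word zs M) =
      F (u M) * (F (b M) * F (?t M) + F (?b' M * ?t M)) +
      (\<tau> (b M) * F (?u M * ?t M) + F (?u M * ?b M * ?t M))" for M
    using expand_F[of "u M" "b M * ?t M"] expand_F[of "b M" "?t M"] expand_Y[of "?u M" "b M" "?t M"]
    by (simp only: mult.assoc)
  then show ?thesis using poly_order_add[OF 5 6] by simp
qed

end

section \<open>Linear coefficients in \<open>M\<close> and auxiliary power series identities\<close>

definition lin_coeff :: "(nat \<Rightarrow> complex) \<Rightarrow> complex" where
  "lin_coeff f = coeff (THE p. \<forall>M. f M = poly p (of_nat M)) 1"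

lemma lin_coeff_eqI:
  assumes "\<And>M. f M = poly p (of_nat M)"
  shows "lin_coeff f = coeff p 1"
proof -
  have "(THE p. \<forall>M. f M = poly p (of_nat M)) = p"
    by (rule the_equality) (use assms poly_eq_of_nat_eqI in auto)
  then show ?thesis by (simp add: lin_coeff_def)
qed

lemma poly_order_0E:
  assumes "f \<in> poly_order k"
  obtains p where "\<And>M. f M = poly p (of_nat M)"
  using poly_order_mono[OF assms, of 0] by (auto simp: poly_order_def)

lemma lin_coeff_add:
  assumes "f \<in> poly_order 0" "g \<in> poly_order 0"
  shows "lin_coeff (\<lambda>M. f M + g M) = lin_coeff f + lin_coeff g"
proof -
  obtain p q where pq: "\<And>M. f M = poly p (of_nat M)" "\<And>M. g M = poly q (of_nat M)"
    using poly_order_0E[OF assms(1)] poly_order_0E[OF assms(2)] by metis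
  then have "f M + g M = poly (p + q) (of_nat M)" for M by simp
  from lin_coeff_eqI[of "\<lambda>M. f M + g M", OF this] lin_coeff_eqI[of f, OF pq(1)] lin_coeff_eqI[of g, OF pq(2)]
  show ?thesis by simp
qed

lemma lin_coeff_cmult:
  assumes "f \<in> poly_order 0"
  shows "lin_coeff (\<lambda>M. c * f M) = c * lin_coeff f"
proof -
  obtain p where p: "\<And>M. f M = poly p (of_nat M)" using poly_order_0E[OF assms] by metis
  then have "c * f M = poly (smult c p) (of_nat M)" for M by simp
  from lin_coeff_eqI[of "\<lambda>M. c * f M", OF this] lin_coeff_eqI[of f, OF p] show ?thesis by simp
qed

lemma lin_coeff_const: "lin_coeff (\<lambda>M. c) = 0"
  using lin_coeff_eqI[of "\<lambda>M. c" "[:c:]"] by simp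

lemma lin_coeff_order_2:
  assumes "f \<in> poly_order 2" shows "lin_coeff f = 0"
proof -
  obtain p where "\<And>M. f M = of_nat M ^ 2 * poly p (of_nat M)"
    using assms unfolding poly_order_def by blast
  then have "f M = poly (monom 1 2 * p) (of_nat M)" for M by (simp add: poly_monom)
  from lin_coeff_eqI[of f, OF this] show ?thesis by (simp add: coeff_monom_mult)
qed

lemma poly_order_sum:
  "(\<And>i. i \<in> A \<Longrightarrow> f i \<in> poly_order k) \<Longrightarrow> (\<lambda>M. \<Sum>i\<in>A. f i M) \<in> poly_order k"
  by (induction A rule: infinite_finite_induct) (auto intro: poly_order_add poly_order_zero)

lemma lin_coeff_sum:
  "(\<And>i. i \<in> A \<Longrightarrow> f i \<in> poly_order 0) \<Longrightarrow>
    lin_coeff (\<lambda>M. \<Sum>i\<in>A. f i M) = (\<Sum>i\<in>A. lin_coeff (f i))"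
proof (induction A rule: infinite_finite_induct)
  case (insert i A)
  then have "lin_coeff (\<lambda>M. f i M + (\<Sum>i\<in>A. f i M)) = lin_coeff (f i) + (\<Sum>i\<in>A. lin_coeff (f i))"
    by (subst lin_coeff_add) (auto intro: poly_order_sum)
  then show ?case using insert by simp
qed (simp_all add: lin_coeff_const)

text \<open>The words of the expanded power are sorted by the position of their first
  \<open>y\<close>.\<close>

lemma power_add_expansion:
  fixes x y :: "'u::complex_algebra_1"
  shows "(x + y) ^ n = x ^ n + (\<Sum>j<n. x ^ j * y * (x + y) ^ (n - 1 - j))"
proof (induction n)
  case (Suc n)
  have "(x + y) ^ Suc n = x * (x + y) ^ n + y * (x + y) ^ n" by (simp add: distrib_right)
  also have "x * (x + y) ^ n = x ^ Suc n + (\<Sum>j<n. x ^ Suc j * y * (x + y) ^ (n - 1 - j))"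
    by (subst Suc) (simp add: distrib_left sum_distrib_left mult.assoc)
  finally show ?case by (simp add: sum.lessThan_Suc_shift del: sum.lessThan_Suc)
qed simp

lemma fps_compose_shift_rec:
  fixes A G :: "complex fps"
  assumes "G $ 0 = 0"
  shows "fps_shift l A oo G = fps_const (A $ l) + G * (fps_shift (Suc l) A oo G)"
proof -
  have "fps_shift l A = fps_const (A $ l) + fps_X * fps_shift (Suc l) A"
    by (rule fps_ext) (simp add: fps_X_mult_nth)
  then have "fps_shift l A oo G = (fps_const (A $ l) + fps_X * fps_shift (Suc l) A) oo G" by simp
  also have "\<dots> = fps_const (A $ l) + G * (fps_shift (Suc l) A oo G)"
    using assms by (simp add: fps_compose_add_distrib fps_compose_mult_distrib)
  finally show ?thesis .
qed

text \<open>Iteration makes \<open>V l\<close> divisible by every power of \<open>G\<close>, and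
  \<open>G\<close> has no constant term.\<close>

lemma fps_eq_of_iterated_multiples:
  fixes V :: "nat \<Rightarrow> complex fps"
  assumes "G $ 0 = 0" "\<And>l. V l = G * V (Suc l)"
  shows "V l = 0"
proof (rule fps_ext)
  fix n
  have "V l = G ^ r * V (l + r)" for r
  proof (induction r)
    case (Suc r)
    also have "V (l + r) = G * V (l + Suc r)" using assms(2)[of "l + r"] by simp
    finally show ?case by (simp add: mult_ac)
  qed simp
  then have "V l $ n = (G ^ Suc n * V (l + Suc n)) $ n" by metis
  also have "\<dots> = 0"
    using startsby_zero_power_prefix[OF assms(1)] by (simp add: fps_mult_nth del: power_Suc)
  finally show "V l $ n = 0 $ n" by simp
qed

section \<open>Generating functions of the first-order terms\<close>

context block_family
begin

text \<open>When the power is multiplied out one factor at a time, \<open>x\<close> is absorbed by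
  the last large-block letter and \<open>y\<close> opens a new pair, so only nonempty pair words
  arise.\<close>

lemma word_power_sum_order:
  assumes "\<And>zs. set zs \<subseteq> Y \<times> X \<Longrightarrow> zs \<noteq> [] \<Longrightarrow> (\<lambda>M. F (p M * pair_word zs M)) \<in> poly_order d"
    and "set zs \<subseteq> Y \<times> X" "zs \<noteq> []"
  shows "(\<lambda>M. F (p M * pair_word zs M * (x M + y M) ^ n)) \<in> poly_order d"
  using assms(2,3)
proof (induction n arbitrary: zs)
  case 0
  then show ?case using assms(1) by simp
next
  case (Suc n)
  obtain ys b a where zs: "zs = ys @ [(b, a)]" "b \<in> Y" "a \<in> X"
    using Suc.prems by (cases zs rule: rev_cases) auto
  have 1: "(\<lambda>M. F (p M * pair_word (ys @ [(b, \<lambda>M. a M * x M)]) M * (x M + y M) ^ n)) \<in> poly_order d"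
    by (rule Suc.IH) (use zs Suc.prems in \<open>auto intro!: poly_family_mult poly_family_self\<close>)
  have 2: "(\<lambda>M. F (p M * pair_word (zs @ [(y, \<lambda>M. 1)]) M * (x M + y M) ^ n)) \<in> poly_order d"
    by (rule Suc.IH) (use Suc.prems in \<open>auto intro!: poly_family_one poly_family_self\<close>)
  have "F (p M * pair_word zs M * (x M + y M) ^ Suc n) =
      F (p M * pair_word (ys @ [(b, \<lambda>M. a M * x M)]) M * (x M + y M) ^ n)
      + F (p M * pair_word (zs @ [(y, \<lambda>M. 1)]) M * (x M + y M) ^ n)" for M
    by (simp add: zs distrib_left distrib_right mult.assoc)
  then show ?case using poly_order_add[OF 1 2] by simp
qed

text \<open>The exponent of \<open>y\<close> is a parameter because replacing a power of
  \<open>x\<close> between two \<open>y\<close> factors by its expectation fuses them and raises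
  \<open>l\<close>.\<close>

definition Z :: "nat \<Rightarrow> nat \<Rightarrow> nat \<Rightarrow> complex" where
  "Z k l n = lin_coeff (\<lambda>M. F (x M ^ k * y M ^ Suc l * (x M + y M) ^ n))"

lemma Z_order: "(\<lambda>M. F (x M ^ k * y M ^ Suc l * (x M + y M) ^ n)) \<in> poly_order (Suc 0)"
proof -
  have "(\<lambda>M. F (x M ^ k * pair_word [(\<lambda>M. y M ^ Suc l, \<lambda>M. 1)] M * (x M + y M) ^ n)) \<in> poly_order (Suc 0)"
  proof (rule word_power_sum_order)
    fix zs assume "set zs \<subseteq> Y \<times> X" "zs \<noteq> []"
    then show "(\<lambda>M. F (x M ^ k * pair_word zs M)) \<in> poly_order (Suc 0)"
      using word_order_1[OF poly_family_power[of x k], of zs] by simp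
  qed (auto intro: poly_family_one poly_family_power_Suc simp del: power_Suc)
  then show ?thesis by (simp add: mult.assoc)
qed

text \<open>With a single small-block letter, centring from the left ends at once: the fully centred
  remainders vanish, and the formula is exact in \<open>M\<close>.\<close>

lemma first_order_moment:
  "F (x M ^ k * y M ^ Suc l * x M ^ n) =
    m k * m n * F (y M ^ Suc l) + (m (k + n) - m k * m n) * \<tau> (y M ^ Suc l)"
proof -
  let ?u = "\<lambda>M. x M ^ k - F (x M ^ k) *\<^sub>C 1"
    and ?b = "\<lambda>M. y M ^ Suc l - \<tau> (y M ^ Suc l) *\<^sub>C 1" and ?b' = "\<lambda>M. y M ^ Suc l - F (y M ^ Suc l) *\<^sub>C 1"
  note X = poly_family_power[of x] and Y = poly_family_power_Suc[of y l "Suc 0"]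
  have 1: "F (?b' M * x M ^ n) = 0"
    using left2_X[OF left2_start[OF Y] X[of n]] .
  have 2: "F (?u M * ?b M * x M ^ n) = 0"
    using left2_X[OF left2_step[OF left1_start[OF X[of k]] Y] X[of n]] .
  have 3: "F (?u M * x M ^ n) = m (k + n) - m k * m n"
    by (simp add: left_diff_distrib mult_scaleC_left F_x flip: power_add)
  have 4: "F (y M ^ Suc l * x M ^ n) = F (y M ^ Suc l) * m n"
    using expand_F[of "y M ^ Suc l" "x M ^ n"] by (simp only: 1 F_x add_0_right)
  have 5: "F (?u M * y M ^ Suc l * x M ^ n) = \<tau> (y M ^ Suc l) * (m (k + n) - m k * m n)"
    using expand_Y[of "?u M" "y M ^ Suc l" "x M ^ n"] by (simp only: 2 3 add_0_right)
  have "F (x M ^ k * (y M ^ Suc l * x M ^ n)) =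
      F (x M ^ k) * F (y M ^ Suc l * x M ^ n) + F (?u M * (y M ^ Suc l * x M ^ n))"
    by (rule expand_F)
  also have "\<dots> = m k * (F (y M ^ Suc l) * m n) + \<tau> (y M ^ Suc l) * (m (k + n) - m k * m n)"
    using 4 5 by (simp only: F_x mult.assoc)
  finally show ?thesis by (simp only: mult.assoc) (simp only: mult_ac)
qed

definition lin_F :: "nat \<Rightarrow> complex" where "lin_F l = lin_coeff (\<lambda>M. F (y M ^ Suc l))"
definition lin_\<tau> :: "nat \<Rightarrow> complex" where "lin_\<tau> l = lin_coeff (\<lambda>M. \<tau> (y M ^ Suc l))"

text \<open>Split \<open>(x + y) ^ n\<close> at its first \<open>y\<close>. The preceding
  \<open>x ^ j\<close> stands between two small-block factors, so up to order 2 it becomes the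
  scalar \<open>s j\<close> and the powers of \<open>y\<close> merge; errors of order 2 have no
  linear coefficient.\<close>

lemma Z_rec:
  "Z k l n = m k * m n * lin_F l + (m (k + n) - m k * m n) * lin_\<tau> l + (\<Sum>j<n. s j * Z k (Suc l) (n - 1 - j))"
proof -
  let ?r = "\<lambda>j M. x M ^ k * y M ^ Suc l * (x M ^ j - \<sigma> (x M ^ j) *\<^sub>C 1) * pair_word [(y, \<lambda>M. 1)] M
      * (x M + y M) ^ (n - 1 - j)"
  let ?z = "\<lambda>j M. F (x M ^ k * y M ^ Suc (Suc l) * (x M + y M) ^ (n - 1 - j))"
  have r: "(\<lambda>M. F (?r j M)) \<in> poly_order 2" for j
  proof (rule word_power_sum_order)
    fix zs assume "set zs \<subseteq> Y \<times> X" "zs \<noteq> []"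
    then show "(\<lambda>M. F (x M ^ k * y M ^ Suc l * (x M ^ j - \<sigma> (x M ^ j) *\<^sub>C 1) * pair_word zs M)) \<in> poly_order 2"
      by (intro word_order_2 poly_family_power poly_family_power_Suc)
  qed (auto intro: poly_family_one poly_family_self)
  have r0: "(\<lambda>M. F (?r j M)) \<in> poly_order 0" for j by (rule poly_order_mono[OF r]) simp
  have z0: "(\<lambda>M. s j * ?z j M) \<in> poly_order 0" for j
    by (intro poly_order_cmult poly_order_mono[OF Z_order]) simp
  have q0: "(\<lambda>M. s j * ?z j M + F (?r j M)) \<in> poly_order 0" for j
    by (rule poly_order_add[OF z0 r0])
  have p0: "(\<lambda>M. m k * m n * F (y M ^ Suc l) + (m (k + n) - m k * m n) * \<tau> (y M ^ Suc l)) \<in> poly_order 0"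
    by (intro poly_order_add poly_order_cmult poly_order_mono[OF F_y] poly_order_mono[OF \<tau>_y]) simp_all
  have "F (x M ^ k * y M ^ Suc l * (x M + y M) ^ n) =
      (m k * m n * F (y M ^ Suc l) + (m (k + n) - m k * m n) * \<tau> (y M ^ Suc l))
      + (\<Sum>j<n. s j * ?z j M + F (?r j M))" for M
  proof -
    have e: "F (x M ^ k * y M ^ Suc l * (x M ^ j * y M * v)) = s j * F (x M ^ k * y M ^ Suc (Suc l) * v)
        + F (x M ^ k * y M ^ Suc l * (x M ^ j - \<sigma> (x M ^ j) *\<^sub>C 1) * y M * v)" for j v
      using expand_X[of "x M ^ k * y M ^ Suc l" "x M ^ j" "y M * v"]
      by (simp add: \<sigma>_x mult.assoc power_Suc2[of _ "Suc l"] del: power_Suc)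
    have "F (x M ^ k * y M ^ Suc l * (x M + y M) ^ n) = F (x M ^ k * y M ^ Suc l * x M ^ n)
        + (\<Sum>j<n. F (x M ^ k * y M ^ Suc l * (x M ^ j * y M * (x M + y M) ^ (n - 1 - j))))"
      by (subst power_add_expansion) (simp only: distrib_left sum_distrib_left F.add F.sum)
    then show ?thesis
      by (simp only: e first_order_moment pair_word.simps mult_1_right)
  qed
  then have "Z k l n = lin_coeff (\<lambda>M. (m k * m n * F (y M ^ Suc l) + (m (k + n) - m k * m n) * \<tau> (y M ^ Suc l))
      + (\<Sum>j<n. s j * ?z j M + F (?r j M)))"
    unfolding Z_def by simp
  also have "\<dots> = lin_coeff (\<lambda>M. m k * m n * F (y M ^ Suc l) + (m (k + n) - m k * m n) * \<tau> (y M ^ Suc l))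
      + (\<Sum>j<n. lin_coeff (\<lambda>M. s j * ?z j M + F (?r j M)))"
    using lin_coeff_add[OF p0 poly_order_sum[OF q0]] lin_coeff_sum[OF q0] by (rule trans[OF _ arg_cong])
  also have "lin_coeff (\<lambda>M. m k * m n * F (y M ^ Suc l) + (m (k + n) - m k * m n) * \<tau> (y M ^ Suc l))
      = m k * m n * lin_F l + (m (k + n) - m k * m n) * lin_\<tau> l"
    unfolding lin_F_def lin_\<tau>_def
    using poly_order_mono[OF F_y[of l], of 0] poly_order_mono[OF \<tau>_y[of l], of 0]
    by (subst lin_coeff_add) (simp_all add: lin_coeff_cmult poly_order_cmult del: power_Suc)
  finally have "Z k l n = m k * m n * lin_F l + (m (k + n) - m k * m n) * lin_\<tau> l
      + (\<Sum>j<n. lin_coeff (\<lambda>M. s j * ?z j M + F (?r j M)))" .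
  moreover have "lin_coeff (\<lambda>M. s j * ?z j M + F (?r j M)) = s j * Z k (Suc l) (n - 1 - j)" for j
    unfolding lin_coeff_add[OF z0 r0] lin_coeff_order_2[OF r] Z_def add_0_right
    by (rule lin_coeff_cmult) (rule poly_order_mono[OF Z_order], simp)
  ultimately show ?thesis by simp
qed

text \<open>By \<open>Z_rec\<close>, raising \<open>l\<close> costs a factor \<open>G\<close>. The
  closed form with shifted coefficient series obeys the same recursion, so the difference
  \<open>V l\<close> equals \<open>G * V (Suc l)\<close> and is 0.\<close>

lemma Z_fps:
  defines "G \<equiv> fps_X * Abs_fps s"
  shows "Abs_fps (Z k 0) = (Abs_fps lin_F oo G) * (fps_const (m k) * Abs_fps m)
    + (Abs_fps lin_\<tau> oo G) * (fps_shift k (Abs_fps m) - fps_const (m k) * Abs_fps m)"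
proof -
  let ?P = "fps_const (m k) * Abs_fps m" and ?Q = "fps_shift k (Abs_fps m) - fps_const (m k) * Abs_fps m"
  define V where "V l = Abs_fps (Z k l) - (fps_shift l (Abs_fps lin_F) oo G) * ?P - (fps_shift l (Abs_fps lin_\<tau>) oo G) * ?Q" for l
  have G0: "G $ 0 = 0" by (simp add: G_def)
  have Z: "Abs_fps (Z k l) = fps_const (lin_F l) * ?P + fps_const (lin_\<tau> l) * ?Q + G * Abs_fps (Z k (Suc l))" for l
  proof (rule fps_ext)
    fix n
    have "(G * Abs_fps (Z k (Suc l))) $ n = (\<Sum>j<n. s j * Z k (Suc l) (n - 1 - j))"
    proof (cases n)
      case (Suc n')
      have "(G * Abs_fps (Z k (Suc l))) $ n = (fps_X * (Abs_fps s * Abs_fps (Z k (Suc l)))) $ n"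
        by (simp only: G_def mult.assoc)
      also have "\<dots> = (Abs_fps s * Abs_fps (Z k (Suc l))) $ n'"
        by (simp only: Suc fps_X_mult_nth) simp
      also have "\<dots> = (\<Sum>j<n. s j * Z k (Suc l) (n - 1 - j))"
        by (simp only: fps_mult_nth fps_nth_Abs_fps Suc lessThan_Suc_atMost atLeast0AtMost) simp
      finally show ?thesis .
    qed (simp add: G_def mult.assoc)
    then show "Abs_fps (Z k l) $ n = (fps_const (lin_F l) * ?P + fps_const (lin_\<tau> l) * ?Q + G * Abs_fps (Z k (Suc l))) $ n"
      by (simp add: Z_rec[of k l n] algebra_simps)
  qed
  have "V l = G * V (Suc l)" for l
    unfolding V_def
    by (subst Z, subst (1 2) fps_compose_shift_rec[OF G0]) (simp add: algebra_simps)
  from fps_eq_of_iterated_multiples[of G V 0, OF G0 this] show ?thesis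
    by (simp add: V_def algebra_simps)
qed

text \<open>Splitting at the first \<open>y\<close> reduces each coefficient to a sum of values
  \<open>Z j 0 (n - 1 - j)\<close>; the summands with shifts of \<open>Abs_fps m\<close> add up to a
  derivative.\<close>

theorem first_order_expansion:
  defines "G \<equiv> fps_X * Abs_fps s"
  shows "Abs_fps (\<lambda>n. lin_coeff (\<lambda>M. F ((x M + y M) ^ n))) =
    fps_X * ((Abs_fps lin_F oo G) * Abs_fps m ^ 2
      + (Abs_fps lin_\<tau> oo G) * (fps_deriv (fps_X * Abs_fps m) - Abs_fps m ^ 2))"
    (is "_ = fps_X * (?U * ?m ^ 2 + ?V * (?D - ?m ^ 2))")
proof (rule fps_ext)
  fix n
  let ?f = "\<lambda>j M. F (x M ^ j * y M * (x M + y M) ^ (n - 1 - j))"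
  have z: "(\<lambda>M. F (x M ^ j * y M * (x M + y M) ^ (n - 1 - j))) \<in> poly_order 0" for j
    using poly_order_mono[OF Z_order[of j 0 "n - 1 - j"], of 0] by simp
  have "F ((x M + y M) ^ n) = m n + (\<Sum>j<n. F (x M ^ j * y M * (x M + y M) ^ (n - 1 - j)))" for M
    by (subst power_add_expansion) (simp add: F.sum F_x)
  then have "lin_coeff (\<lambda>M. F ((x M + y M) ^ n)) =
      (\<Sum>j<n. lin_coeff (\<lambda>M. F (x M ^ j * y M * (x M + y M) ^ (n - 1 - j))))"
    using lin_coeff_add[OF poly_order_const poly_order_sum, of "{..<n}" ?f "m n"]
      lin_coeff_sum[of "{..<n}" ?f] z
    by (simp only: lin_coeff_const add_0_left)
  also have "\<dots> = (\<Sum>j<n. Z j 0 (n - 1 - j))" by (simp add: Z_def)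
  also have "\<dots> = (fps_X * (?U * ?m ^ 2 + ?V * (?D - ?m ^ 2))) $ n"
  proof (cases n)
    case (Suc N)
    have Z: "Z j 0 i = (fps_const (m j) * ((?U - ?V) * ?m)) $ i + (?V * fps_shift j ?m) $ i" for i j
    proof -
      have "Z j 0 i = Abs_fps (Z j 0) $ i" by simp
      also have "Abs_fps (Z j 0) = fps_const (m j) * ((?U - ?V) * ?m) + ?V * fps_shift j ?m"
        unfolding Z_fps G_def by (simp add: algebra_simps)
      finally show ?thesis by simp
    qed
    have "(\<Sum>j<n. Z j 0 (n - 1 - j)) =
        (\<Sum>j\<le>N. m j * ((?U - ?V) * ?m) $ (N - j)) + (\<Sum>j\<le>N. (?V * fps_shift j ?m) $ (N - j))"
      unfolding Z by (simp add: Suc lessThan_Suc_atMost sum.distrib)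
    also have "(\<Sum>j\<le>N. m j * ((?U - ?V) * ?m) $ (N - j)) = (?m * ((?U - ?V) * ?m)) $ N"
      by (simp add: fps_mult_nth[of ?m] atLeast0AtMost)
    also have "(\<Sum>j\<le>N. (?V * fps_shift j ?m) $ (N - j)) = (?V * ?D) $ N"
    proof -
      have "(\<Sum>j\<le>N. (?V * fps_shift j ?m) $ (N - j)) = (\<Sum>j\<le>N. \<Sum>i\<le>N - j. ?V $ i * m (N - i))"
        by (intro sum.cong refl) (auto simp: fps_mult_nth atLeast0AtMost intro!: sum.cong)
      also have "\<dots> = (\<Sum>i\<le>N. \<Sum>j\<le>N - i. ?V $ i * m (N - i))"
      proof -
        have "(\<Sum>j\<le>N. \<Sum>i\<le>N - j. ?V $ i * m (N - i))
            = (\<Sum>j\<le>N. \<Sum>i\<in>{i \<in> {..N}. i + j \<le> N}. ?V $ i * m (N - i))"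
          by (intro sum.cong refl) auto
        also have "\<dots> = (\<Sum>i\<le>N. \<Sum>j\<in>{j \<in> {..N}. i + j \<le> N}. ?V $ i * m (N - i))"
          by (rule sum.swap_restrict) auto
        also have "\<dots> = (\<Sum>i\<le>N. \<Sum>j\<le>N - i. ?V $ i * m (N - i))"
          by (intro sum.cong refl) auto
        finally show ?thesis .
      qed
      \<comment> \<open>The inner sum has \<open>N - i + 1\<close> equal terms, which is the factor
        produced by differentiating \<open>fps_X * ?m\<close>.\<close>
      also have "\<dots> = (?V * ?D) $ N"
      proof -
        have D: "?D $ i = of_nat (Suc i) * m i" for i
          by (simp only: fps_deriv_nth fps_X_mult_nth) simp
        show ?thesis
          by (simp only: fps_mult_nth[of ?V ?D] D atLeast0AtMost) (simp add: mult_ac)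
      qed
      finally show ?thesis .
    qed
    also have "(?m * ((?U - ?V) * ?m)) $ N + (?V * ?D) $ N = (?m * ((?U - ?V) * ?m) + ?V * ?D) $ N"
      by (rule fps_add_nth[symmetric])
    also have "?m * ((?U - ?V) * ?m) + ?V * ?D = ?U * ?m ^ 2 + ?V * (?D - ?m ^ 2)"
      by (simp only: power2_eq_square left_diff_distrib right_diff_distrib) (simp only: ac_simps, simp)
    also have "\<dots> $ N = (fps_X * (?U * ?m ^ 2 + ?V * (?D - ?m ^ 2))) $ n"
      by (simp only: Suc fps_X_mult_nth) simp
    finally show ?thesis .
  qed simp
  finally show "Abs_fps (\<lambda>n. lin_coeff (\<lambda>M. F ((x M + y M) ^ n))) $ n
      = (fps_X * (?U * ?m ^ 2 + ?V * (?D - ?m ^ 2))) $ n" by simp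
qed

end

section \<open>Evolution of the reciprocal Cauchy transforms\<close>

lemma has_t_deriv_unique: "has_t_deriv H D t \<Longrightarrow> has_t_deriv H E t \<Longrightarrow> D = E"
  by (rule fls_eqI) (auto simp: has_t_deriv_def intro: vector_derivative_unique_at)

lemma t_deriv_eqI: "has_t_deriv H D t \<Longrightarrow> t_deriv H t = D"
  unfolding t_deriv_def using has_t_deriv_unique by (intro the_equality) auto

definition coeffwise_deriv :: "(real \<Rightarrow> complex fps) \<Rightarrow> complex fps \<Rightarrow> real \<Rightarrow> bool" where
  "coeffwise_deriv S D t \<longleftrightarrow> (\<forall>n. ((\<lambda>s. S s $ n) has_vector_derivative D $ n) (at t))"

text \<open>The coefficients of an inverse with constant term 1 satisfy a finite recursion. Its
  derivative is the recursion satisfied by the claimed series, so induction on the coefficient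
  applies.\<close>

lemma coeffwise_deriv_inverse:
  assumes "coeffwise_deriv S D t" "\<And>s. S s $ 0 = 1"
  shows "coeffwise_deriv (\<lambda>s. inverse (S s)) (- D * inverse (S t) ^ 2) t"
proof -
  let ?E = "- D * inverse (S t) ^ 2"
  have rec: "inverse (S s) $ n = - (\<Sum>i=1..n. S s $ i * inverse (S s) $ (n - i))" if "n > 0" for s n
  proof -
    have "(S s * inverse (S s)) $ n = 0"
      using that assms(2)[of s] by (simp add: inverse_mult_eq_1')
    then show ?thesis
      using assms(2)[of s] by (simp add: fps_mult_nth sum.atLeast_Suc_atMost[of 0] eq_neg_iff_add_eq_0)
  qed
  have recE: "?E $ n = - (\<Sum>i=1..n. S t $ i * ?E $ (n - i) + D $ i * inverse (S t) $ (n - i))" for n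
  proof -
    \<comment> \<open>The constant coefficient stays equal to 1, so \<open>D\<close> has none and
      the summand with \<open>i = 0\<close> reduces to the left-hand side of the recursion.\<close>
    have "((\<lambda>s. S s $ 0) has_vector_derivative 0) (at t)" by (simp add: assms(2))
    then have D0: "D $ 0 = 0"
      using assms(1) vector_derivative_unique_at unfolding coeffwise_deriv_def by blast
    have "S t * ?E = - D * (S t * inverse (S t)) * inverse (S t)"
      by (simp only: power2_eq_square mult_ac)
    also have "\<dots> = - (D * inverse (S t))"
      using assms(2)[of t] by (simp add: inverse_mult_eq_1')
    finally have e: "S t * ?E = - (D * inverse (S t))" .
    have "(S t * ?E + D * inverse (S t)) $ n = 0" by (simp only: e) simp
    then have "(\<Sum>i=0..n. S t $ i * ?E $ (n - i) + D $ i * inverse (S t) $ (n - i)) = 0"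
      by (simp only: fps_add_nth fps_mult_nth[of "S t" ?E] fps_mult_nth[of D "inverse (S t)"] sum.distrib)
    then show ?thesis
      unfolding sum.atLeast_Suc_atMost[of 0 n, OF le0] assms(2) D0
      by (simp only: diff_zero mult_1_left mult_zero_left add_0_right eq_neg_iff_add_eq_0 One_nat_def)
  qed
  have "((\<lambda>s. inverse (S s) $ n) has_vector_derivative ?E $ n) (at t)" for n
  proof (induction n rule: less_induct)
    case (less n)
    show ?case
    proof (cases "n = 0")
      case True
      have "inverse (S s) $ 0 = 1" for s by (simp add: assms(2))
      then show ?thesis using True recE[of 0] by simp
    next
      case False
      have "((\<lambda>s. - (\<Sum>i=1..n. S s $ i * inverse (S s) $ (n - i))) has_vector_derivative
          - (\<Sum>i=1..n. S t $ i * ?E $ (n - i) + D $ i * inverse (S t) $ (n - i))) (at t)"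
        using assms(1) less unfolding coeffwise_deriv_def
        by (intro has_vector_derivative_minus has_vector_derivative_sum has_vector_derivative_mult) auto
      then show ?thesis
        unfolding recE[of n, symmetric] using False by (simp add: rec)
    qed
  qed
  then show ?thesis by (simp add: coeffwise_deriv_def)
qed

lemma reciprocal_fps_X_mult:
  fixes S :: "complex fps"
  assumes "S $ 0 = 1"
  shows "1 / fps_to_fls (fps_X * S) = fls_shift 1 (fps_to_fls (inverse S))"
proof -
  have "S * inverse S = 1" using assms by (simp add: inverse_mult_eq_1')
  then have "fps_to_fls S * fps_to_fls (inverse S) = 1"
    by (metis fls_times_fps_to_fls fps_one_to_fls)
  then have "fps_to_fls (fps_X * S) * fls_shift 1 (fps_to_fls (inverse S)) = 1"
    by (simp add: fls_times_fps_to_fls fls_X_times_conv_shift fls_shifted_times_simps)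
  then show ?thesis by (metis div_by_1 nonzero_mult_div_cancel_left mult_zero_left zero_neq_one)
qed

lemma has_t_deriv_reciprocal:
  assumes "coeffwise_deriv S D t" "\<And>s. S s $ 0 = 1"
  shows "has_t_deriv (\<lambda>s. 1 / fps_to_fls (fps_X * S s))
    (- fps_to_fls (fps_X * D) / fps_to_fls (fps_X * S t) ^ 2) t"
proof -
  have "- fps_to_fls (fps_X * D) / fps_to_fls (fps_X * S t) ^ 2
      = - fps_to_fls (fps_X * D) * (1 / fps_to_fls (fps_X * S t)) * (1 / fps_to_fls (fps_X * S t))"
    by (simp add: power2_eq_square)
  also have "\<dots> = fls_shift 1 (fps_to_fls (- D * inverse (S t) ^ 2))"
    unfolding reciprocal_fps_X_mult[OF assms(2)]
    by (simp add: fls_times_fps_to_fls fps_to_fls_power power2_eq_square fls_X_times_conv_shift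
        fls_shifted_times_simps mult.assoc)
  finally show ?thesis
    using coeffwise_deriv_inverse[OF assms]
    unfolding has_t_deriv_def coeffwise_deriv_def reciprocal_fps_X_mult[OF assms(2)]
    by (auto simp: fps_to_fls_nth)
qed

lemma fls_deriv_reciprocal:
  fixes g :: "complex fls"
  assumes "g \<noteq> 0" shows "fls_deriv (1 / g) = - fls_deriv g / g ^ 2"
proof -
  have "0 = fls_deriv (g * (1 / g))" using assms by simp
  also have "\<dots> = g * fls_deriv (1 / g) + fls_deriv g * (1 / g)" by (rule fls_deriv_mult)
  finally show ?thesis using assms by (simp add: field_simps power2_eq_square eq_neg_iff_add_eq_0)
qed

section \<open>Power series with coefficients polynomial in time\<close>

definition polynomial_family :: "(complex \<Rightarrow> complex fps) \<Rightarrow> bool" where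
  "polynomial_family H \<longleftrightarrow> (\<forall>n. \<exists>p. \<forall>z. H z $ n = poly p z)"

lemma polynomial_family_eqI:
  assumes "polynomial_family H" "polynomial_family K" "\<And>N. H (of_nat N) = K (of_nat N)"
  shows "H z = K z"
proof (rule fps_ext)
  fix n
  obtain p q where pq: "\<And>z. H z $ n = poly p z" "\<And>z. K z $ n = poly q z"
    using assms(1,2) unfolding polynomial_family_def by meson
  have "p = q" by (rule poly_eq_of_nat_eqI) (use pq assms(3) in metis)
  with pq show "H z $ n = K z $ n" by simp
qed

lemma polynomial_family_const: "polynomial_family (\<lambda>z. A)"
  unfolding polynomial_family_def by (auto intro!: exI[of _ "[:_:]"])

lemma polynomial_family_add:
  assumes "polynomial_family H" "polynomial_family K"
  shows "polynomial_family (\<lambda>z. H z + K z)"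
  unfolding polynomial_family_def
proof
  fix n
  obtain p q where "\<And>z. H z $ n = poly p z" "\<And>z. K z $ n = poly q z"
    using assms unfolding polynomial_family_def by meson
  then have "\<forall>z. (H z + K z) $ n = poly (p + q) z" by simp
  then show "\<exists>p. \<forall>z. (H z + K z) $ n = poly p z" ..
qed

lemma polynomial_family_mult:
  assumes "polynomial_family H" "polynomial_family K"
  shows "polynomial_family (\<lambda>z. H z * K z)"
  unfolding polynomial_family_def
proof
  fix n
  obtain p q where "\<And>n z. H z $ n = poly (p n) z" "\<And>n z. K z $ n = poly (q n) z"
    using assms unfolding polynomial_family_def by metis
  then have "\<forall>z. (H z * K z) $ n = poly (\<Sum>i=0..n. p i * q (n - i)) z"
    by (simp add: fps_mult_nth poly_sum)
  then show "\<exists>p. \<forall>z. (H z * K z) $ n = poly p z" ..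
qed

lemma polynomial_family_diff:
  "polynomial_family H \<Longrightarrow> polynomial_family K \<Longrightarrow> polynomial_family (\<lambda>z. H z - K z)"
  using polynomial_family_add[OF _ polynomial_family_mult[OF polynomial_family_const[of "-1"]], of H K] by simp

lemma polynomial_family_power: "polynomial_family H \<Longrightarrow> polynomial_family (\<lambda>z. H z ^ i)"
  by (induction i) (auto intro: polynomial_family_mult polynomial_family_const)

lemma polynomial_family_compose:
  assumes "polynomial_family H" shows "polynomial_family (\<lambda>z. A oo H z)"
  unfolding polynomial_family_def
proof
  fix n
  obtain p where "\<And>i n z. (H z ^ i) $ n = poly (p i n) z"
    using polynomial_family_power[OF assms] unfolding polynomial_family_def by metis
  then have "\<forall>z. (A oo H z) $ n = poly (\<Sum>i=0..n. smult (A $ i) (p i n)) z"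
    by (simp add: fps_compose_nth poly_sum)
  then show "\<exists>p. \<forall>z. (A oo H z) $ n = poly p z" ..
qed

lemma polynomial_family_deriv:
  assumes "polynomial_family H" shows "polynomial_family (\<lambda>z. fps_deriv (H z))"
  unfolding polynomial_family_def
proof
  fix n
  obtain p where "\<And>z. H z $ Suc n = poly p z"
    using assms unfolding polynomial_family_def by meson
  then have "\<forall>z. fps_deriv (H z) $ n = poly (smult (of_nat (Suc n)) p) z"
    by (simp add: algebra_simps)
  then show "\<exists>p. \<forall>z. fps_deriv (H z) $ n = poly p z" ..
qed

section \<open>Moment series of the one-parameter group and its evolution\<close>

locale alpha_pair_nat = alpha_pair \<psi> \<theta> \<Psi> \<Theta>
  for \<psi> \<theta> :: "'a::complex_algebra_1 \<Rightarrow> complex"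
    and \<Psi> \<Theta> :: "(nat, 'a) free_product \<Rightarrow> complex" +
  fixes a :: 'a
begin

sublocale spread: spreadable_functional "outer d" for d
proof
  fix A :: "nat set" and f :: "nat \<Rightarrow> nat" and w :: "(nat \<times> 'a) list"
  assume "strict_mono_on A f" "fst ` set w \<subseteq> A"
  then show "outer d (word_prod f w) = outer d (word_prod id w)"
    using word_prod_strict_mono_invariant[OF unital(3,1,1,2) vanishes(1)]
      word_prod_strict_mono_invariant[OF unital(4,2,1,2) vanishes(2)]
    by (auto simp: outer_def)
qed

abbreviation P :: "bool \<Rightarrow> nat \<Rightarrow> complex poly" where
  "P d n \<equiv> moment_poly (outer d) a n"

lemma poly_P: "poly (P d n) (of_nat N) = outer d (dot N a ^ n)"
  by (rule spread.poly_moment_poly)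

lemma shifted_moment: "outer d ((\<Sum>j\<in>{k..<k + N}. embed j a) ^ n) = poly (P d n) (of_nat N)"
proof -
  have "(\<Sum>j\<in>{k..<k + N}. embed j a) = (\<Sum>j\<in>{..<N}. embed (k + j) a)"
    by (rule sum.reindex_bij_witness[of _ "\<lambda>j. k + j" "\<lambda>j. j - k"]) auto
  moreover have "strict_mono_on {..<N} (\<lambda>j. k + j)" by (auto simp: strict_mono_on_def)
  ultimately show ?thesis
    using spread.moment_reindex[of "{..<N}" "\<lambda>j. k + j" d a n] by (simp add: poly_P dot_def)
qed

lemma dot_add: "dot (M + N) a = dot M a + (\<Sum>j\<in>{M..<M + N}. embed j a)"
  unfolding dot_def by (simp add: lessThan_atLeast0 sum.atLeastLessThan_concat)

lemma P_0: "P d 0 = 1"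
  by (rule poly_eq_of_nat_eqI) (simp add: poly_P)

lemma P_Suc_at_0: "poly (P d (Suc n)) 0 = 0"
  using poly_P[of d "Suc n" 0] by (simp add: dot_def)

lemma P_Suc_order: "(\<lambda>M. poly (P d (Suc n)) (of_nat M)) \<in> poly_order 1"
proof -
  obtain q where "P d (Suc n) = [:0, 1:] * q"
    using P_Suc_at_0[of d n] by (auto simp: poly_eq_0_iff_dvd elim: dvdE)
  then show ?thesis by (auto simp: poly_order_def)
qed

text \<open>
  The flag \<open>b\<close> tells whether the large block, of \<open>N\<close> copies, lies above the small one, of \<open>M\<close> copies;
  its interior functional is then \<open>outer b\<close>.
\<close>

definition big :: "nat \<Rightarrow> bool \<Rightarrow> nat \<Rightarrow> nat set" where
  "big N b M = (if b then {M..<M + N} else {..<N})"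

definition small :: "nat \<Rightarrow> bool \<Rightarrow> nat \<Rightarrow> nat set" where
  "small N b M = (if b then {..<M} else {N..<N + M})"

lemma big_moment: "outer d ((\<Sum>j\<in>big N b M. embed j a) ^ n) = poly (P d n) (of_nat N)"
  using shifted_moment[of d M N n] shifted_moment[of d 0 N n]
  by (simp add: big_def lessThan_atLeast0)

lemma small_moment: "outer d ((\<Sum>j\<in>small N b M. embed j a) ^ n) = poly (P d n) (of_nat M)"
  using shifted_moment[of d N M n] shifted_moment[of d 0 M n]
  by (simp add: small_def lessThan_atLeast0)

lemma big_plus_small: "(\<Sum>j\<in>big N b M. embed j a) + (\<Sum>j\<in>small N b M. embed j a) = dot (M + N) a"
  using dot_add[of M N] dot_add[of N M] by (auto simp: big_def small_def dot_def add.commute)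

lemma block_family:
  "block_family (outer d) (outer b) (outer (\<not> b))
    (\<lambda>M. block (big N b M)) (\<lambda>M. block (small N b M))
    (\<lambda>M. tails (big N b M) b) (\<lambda>M. tails (small N b M) (\<not> b))
    (\<lambda>M. \<Sum>j\<in>big N b M. embed j a) (\<lambda>M. \<Sum>j\<in>small N b M. embed j a)
    (\<lambda>n. poly (P b n) (of_nat N)) (\<lambda>n. poly (P d n) (of_nat N))"
proof -
  have sep: "i \<noteq> j \<and> (j < i) = b" if "i \<in> big N b M" "j \<in> small N b M" for i j M
    using that by (cases b) (auto simp: big_def small_def)
  have sep': "i \<noteq> j \<and> (j < i) = (\<not> b)" if "i \<in> small N b M" "j \<in> big N b M" for i j M
    using that by (cases b) (auto simp: big_def small_def)
  show ?thesis
  proof (intro block_family.intro block_family_axioms.intro, goal_cases)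
    case 1
    show ?case by unfold_locales
  next
    case 2
    show ?case by unfold_locales
  next
    case 3
    show ?case by unfold_locales
  next
    case 4
    show ?case by (rule block_one)
  next
    case 5
    show ?case by (rule block_one)
  next
    case 6
    then show ?case by (rule block_add)
  next
    case 7
    then show ?case by (rule block_add)
  next
    case 8
    then show ?case by (rule block_scaleC)
  next
    case 9
    then show ?case by (rule block_scaleC)
  next
    case 10
    then show ?case by (rule block_mult)
  next
    case 11
    then show ?case by (rule block_mult)
  next
    case 12
    show ?case by (intro block_sum block_embed)
  next
    case 13
    show ?case by (intro block_sum block_embed)
  next
    case 14
    then show ?case by (rule block_minus_scalar_in_tails) blast
  next
    case 15
    then show ?case by (rule interior_block_in_tails)
  next
    case 16
    then show ?case by (rule interior_block_in_tails)
  next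
    case 17
    then show ?case by (intro interior_block_mult_tails[OF sep])
  next
    case 18
    then show ?case by (intro interior_block_mult_tails[OF sep']) simp_all
  next
    case 19
    then show ?case by (intro outer_block_mult_tails[OF sep])
  next
    case 20
    then show ?case by (intro outer_block_mult_tails[OF sep']) simp_all
  next
    case 21
    show ?case by (rule big_moment)
  next
    case 22
    show ?case by (rule big_moment)
  next
    case 23
    show ?case unfolding small_moment using P_Suc_order by simp
  next
    case 24
    show ?case unfolding small_moment using P_Suc_order by simp
  qed
qed

definition S :: "bool \<Rightarrow> complex \<Rightarrow> complex fps" where
  "S d z = Abs_fps (\<lambda>n. poly (P d n) z)"

definition S' :: "bool \<Rightarrow> complex \<Rightarrow> complex fps" where
  "S' d z = Abs_fps (\<lambda>n. poly (pderiv (P d n)) z)"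

text \<open>Up to sign these are the series \<open>B\<close> and \<open>C\<close> in powers of
  \<open>1/z\<close>, by \<open>t_deriv_F_0\<close>.\<close>

definition \<beta> :: "bool \<Rightarrow> complex fps" where
  "\<beta> d = Abs_fps (\<lambda>n. coeff (P d (Suc n)) 1)"

text \<open>When \<open>N\<close> copies grow to \<open>N + M\<close>, the linear coefficient in
  \<open>M\<close> of a moment is the derivative of its polynomial at \<open>N\<close>;
  \<open>first_order_expansion\<close> computes that coefficient.\<close>

lemma S_evolution_nat:
  "S' d (of_nat N) = fps_X * ((\<beta> d oo fps_X * S b (of_nat N)) * S d (of_nat N) ^ 2
    + (\<beta> (\<not> b) oo fps_X * S b (of_nat N)) * (fps_deriv (fps_X * S d (of_nat N)) - S d (of_nat N) ^ 2))"
proof -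
  interpret block_family "outer d" "outer b" "outer (\<not> b)"
    "\<lambda>M. block (big N b M)" "\<lambda>M. block (small N b M)"
    "\<lambda>M. tails (big N b M) b" "\<lambda>M. tails (small N b M) (\<not> b)"
    "\<lambda>M. \<Sum>j\<in>big N b M. embed j a" "\<lambda>M. \<Sum>j\<in>small N b M. embed j a"
    "\<lambda>n. poly (P b n) (of_nat N)" "\<lambda>n. poly (P d n) (of_nat N)"
    by (rule block_family)
  have b: "Abs_fps lin_F = \<beta> d" and t: "Abs_fps lin_\<tau> = \<beta> (\<not> b)"
    unfolding lin_F_def lin_\<tau>_def \<beta>_def small_moment by (simp_all add: lin_coeff_eqI)
  have "lin_coeff (\<lambda>M. outer d (dot (M + N) a ^ n)) = poly (pderiv (P d n)) (of_nat N)" for n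
  proof -
    have "outer d (dot (M + N) a ^ n) = poly (pcompose (P d n) [:of_nat N, 1:]) (of_nat M)" for M
      by (simp add: poly_pcompose add.commute flip: poly_P)
    from lin_coeff_eqI[of "\<lambda>M. outer d (dot (M + N) a ^ n)", OF this]
    have "lin_coeff (\<lambda>M. outer d (dot (M + N) a ^ n)) = poly (pderiv (pcompose (P d n) [:of_nat N, 1:])) 0"
      by (simp add: poly_0_coeff_0 coeff_pderiv)
    then show ?thesis by (simp add: pderiv_pcompose pderiv_pCons poly_pcompose)
  qed
  with first_order_expansion show ?thesis
    unfolding big_plus_small b t S_def S'_def by simp
qed

lemma polynomial_family_S: "polynomial_family (S d)" and polynomial_family_S': "polynomial_family (S' d)"
  unfolding polynomial_family_def S_def S'_def by auto

text \<open>Every coefficient of either side is a polynomial in \<open>z\<close>, so agreement at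
  the natural numbers suffices.\<close>

lemma S_evolution:
  "S' d z = fps_X * ((\<beta> d oo fps_X * S b z) * S d z ^ 2
    + (\<beta> (\<not> b) oo fps_X * S b z) * (fps_deriv (fps_X * S d z) - S d z ^ 2))"
  by (rule polynomial_family_eqI[OF polynomial_family_S' _ S_evolution_nat])
    (intro polynomial_family_mult polynomial_family_add polynomial_family_diff polynomial_family_power
      polynomial_family_compose polynomial_family_deriv polynomial_family_const polynomial_family_S)

lemma S_nth_0: "S d z $ 0 = 1"
  by (simp add: S_def P_0)

lemma S_coeffwise_deriv:
  "coeffwise_deriv (\<lambda>s. S d (of_real s)) (S' d (of_real t)) t"
  unfolding coeffwise_deriv_def S_def S'_def
  by (auto intro!: has_vector_derivative_real_field poly_DERIV)

definition G :: "bool \<Rightarrow> real \<Rightarrow> complex fps" where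
  "G d t = fps_X * S d (of_real t)"

lemma G_nonzero: "G d t \<noteq> 0" and G_nth_0: "G d t $ 0 = 0"
proof -
  have "S d (of_real t) \<noteq> 0" using S_nth_0[of d "of_real t"] by force
  then show "G d t \<noteq> 0" by (simp add: G_def)
qed (simp add: G_def)

definition F :: "bool \<Rightarrow> real \<Rightarrow> complex fls" where
  "F d t = F_transform (convolution_group (outer d) a t)"

lemma F_eq: "F d t = 1 / fps_to_fls (G d t)"
proof -
  have "distribution_of_moments m (monom 1 n) = m n" for m n
  proof -
    have "coeff (monom 1 n) i * m i = (if i = n then m i else 0)" for i by simp
    then show ?thesis by (simp only: distribution_of_moments_def degree_monom_eq[OF one_neq_zero]) simp
  qed
  then show ?thesis
    by (simp add: F_def F_transform_def G_transform_def convolution_group_def G_def S_def mult.commute)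
qed

lemma F_has_t_deriv:
  "has_t_deriv (F d) (- fps_to_fls (fps_X * S' d (of_real t)) / fps_to_fls (G d t) ^ 2) t"
  using has_t_deriv_reciprocal[OF S_coeffwise_deriv S_nth_0, of d t]
  unfolding F_eq[abs_def] G_def .

text \<open>At time 0 the moment series is 1, so \<open>G d 0\<close> is \<open>fps_X\<close>;
  dividing \<open>fps_X * S' d 0\<close>, that is \<open>fps_X ^ 2 * \<beta> d\<close>, by its
  square leaves \<open>\<beta> d\<close>.\<close>

lemma t_deriv_F_0: "t_deriv (F d) 0 = - fps_to_fls (\<beta> d)"
proof (rule t_deriv_eqI)
  have S0: "S d 0 = 1"
    by (rule fps_ext) (auto simp: S_def P_0 P_Suc_at_0 gr0_conv_Suc)
  have S'0: "S' d 0 = fps_X * \<beta> d"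
  proof (rule fps_ext)
    fix n
    show "S' d 0 $ n = (fps_X * \<beta> d) $ n"
      by (cases n) (simp_all add: S'_def \<beta>_def P_0 poly_0_coeff_0 coeff_pderiv)
  qed
  have "- fps_to_fls (fps_X * S' d 0) / fps_to_fls (G d 0) ^ 2 = - fps_to_fls (\<beta> d)"
    by (simp add: S0 S'0 G_def fls_times_fps_to_fls power2_eq_square fls_X_times_conv_shift)
  with F_has_t_deriv[of d 0] show "has_t_deriv (F d) (- fps_to_fls (\<beta> d)) 0" by simp
qed

text \<open>Since \<open>1 / F b t\<close> is the series \<open>G b t\<close>, substituting
  \<open>F b t\<close> for \<open>z\<close> is composition with \<open>G b t\<close>.\<close>

lemma compose_F: "(- fps_to_fls A) \<circ>\<^sub>z F b t = - fps_to_fls (A oo G b t)"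
  by (simp add: z_compose_def F_eq G_nonzero G_nth_0)

text \<open>This is \<open>S_evolution\<close> multiplied by \<open>fps_X\<close> and divided by
  \<open>- G d t ^ 2\<close>; the term with the derivative of \<open>G d t\<close> turns into the
  \<open>z\<close>-derivative of its reciprocal \<open>F d t\<close>.\<close>

theorem F_evolution:
  "has_t_deriv (F d)
    ((t_deriv (F d) 0 \<circ>\<^sub>z F b t) + (t_deriv (F (\<not> b)) 0 \<circ>\<^sub>z F b t) * (z_deriv (F d t) - 1)) t"
proof -
  define g where "g = fps_to_fls (G d t)"
  define u where "u = fps_to_fls (\<beta> d oo G b t)"
  define v where "v = fps_to_fls (\<beta> (\<not> b) oo G b t)"
  have g: "g \<noteq> 0" using G_nonzero[of d t] by (simp add: g_def)
  have z: "z_deriv (F d t) = fls_X ^ 2 * fls_deriv g / g ^ 2"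
    using fls_deriv_reciprocal[OF g] by (simp add: z_deriv_def F_eq flip: g_def)
  have "fps_X * S' d (of_real t) =
      (\<beta> d oo G b t) * G d t ^ 2 + (\<beta> (\<not> b) oo G b t) * (fps_X ^ 2 * fps_deriv (G d t) - G d t ^ 2)"
    unfolding S_evolution[of d "of_real t" b] G_def[symmetric]
    by (simp add: G_def power2_eq_square algebra_simps del: fps_deriv_mult)
  then have "fps_to_fls (fps_X * S' d (of_real t)) = u * g ^ 2 + v * (fls_X ^ 2 * fls_deriv g - g ^ 2)"
    by (simp only: fps_to_fls_plus fps_to_fls_minus fls_times_fps_to_fls fps_to_fls_power
        fls_deriv_fps_to_fls fps_X_to_fls u_def v_def g_def)
  then have "- fps_to_fls (fps_X * S' d (of_real t)) / g ^ 2
      = - u + (- v) * (fls_X ^ 2 * fls_deriv g / g ^ 2 - 1)"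
    using g by (simp add: field_simps)
  with F_has_t_deriv[of d t] show ?thesis
    by (simp only: t_deriv_F_0 compose_F z u_def[symmetric] v_def[symmetric] g_def[symmetric])
qed

end

text \<open>Subtracting \<open>R\<close> times the first equation from \<open>P\<close> times the
  second eliminates \<open>D\<close>.\<close>

lemma evolution_quotient:
  fixes D P Q R X :: "complex fls"
  assumes "X = P * D" "X = Q + R * (D - 1)" "P - R \<noteq> 0"
  shows "X = P * (Q - R) / (P - R)"
proof -
  have "(P - R) * X = P * (Q + R * (D - 1)) - R * (P * D)"
    using assms(1,2) by (simp add: left_diff_distrib)
  also have "\<dots> = P * (Q - R)" by (simp add: algebra_simps)
  finally show ?thesis using assms(3) by (simp add: nonzero_eq_divide_eq mult.commute)
qed

theorem corollary6p3:
  fixes \<phi> \<psi> \<theta> :: "'a::complex_algebra_1 \<Rightarrow> complex"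
    and \<Phi> \<Psi> \<Theta> :: "(nat, 'a) free_product \<Rightarrow> complex"
    and a :: 'a
    and F\<mu> F\<nu> :: "real \<Rightarrow> complex fls"
    and B C :: "complex fls"
    and t :: real
  assumes "unital_linear \<phi>" and "unital_linear \<psi>" and "unital_linear \<theta>"
    and "alpha_free_product (\<lambda>_. \<phi>) (\<lambda>_. \<psi>) (\<lambda>_. \<theta>) \<Phi> \<Psi> \<Theta>"
    and "F\<mu> = (\<lambda>s. F_transform (convolution_group \<Psi> a s))"
    and "F\<nu> = (\<lambda>s. F_transform (convolution_group \<Theta> a s))"
    and "B = t_deriv F\<mu> 0"
    and "C = t_deriv F\<nu> 0"
  shows
    "has_t_deriv F\<mu> ((B \<circ>\<^sub>z F\<nu> t) * z_deriv (F\<mu> t)) t \<and>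
     has_t_deriv F\<nu> ((C \<circ>\<^sub>z F\<mu> t) * z_deriv (F\<nu> t)) t \<and>
     has_t_deriv F\<mu> ((B \<circ>\<^sub>z F\<mu> t) + (C \<circ>\<^sub>z F\<mu> t) * (z_deriv (F\<mu> t) - 1)) t \<and>
     has_t_deriv F\<nu> ((C \<circ>\<^sub>z F\<nu> t) + (B \<circ>\<^sub>z F\<nu> t) * (z_deriv (F\<nu> t) - 1)) t \<and>
     ((B \<circ>\<^sub>z F\<nu> t) - (C \<circ>\<^sub>z F\<mu> t) \<noteq> 0 \<longrightarrow>
        has_t_deriv F\<mu>
          ((B \<circ>\<^sub>z F\<nu> t) * ((B \<circ>\<^sub>z F\<mu> t) - (C \<circ>\<^sub>z F\<mu> t)) /
             ((B \<circ>\<^sub>z F\<nu> t) - (C \<circ>\<^sub>z F\<mu> t))) t \<and>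
        has_t_deriv F\<nu>
          ((C \<circ>\<^sub>z F\<mu> t) * ((B \<circ>\<^sub>z F\<nu> t) - (C \<circ>\<^sub>z F\<nu> t)) /
             ((B \<circ>\<^sub>z F\<nu> t) - (C \<circ>\<^sub>z F\<mu> t))) t)"
proof -
  interpret alpha_pair_nat \<psi> \<theta> \<Psi> \<Theta> a
    using assms(2-4) by unfold_locales (auto simp: alpha_free_product_def)
  have F: "F\<mu> = F True" "F\<nu> = F False"
    by (auto simp: assms(5,6) F_def outer_def)
  have BC: "B = t_deriv (F True) 0" "C = t_deriv (F False) 0"
    by (simp_all add: assms(7,8) F)
  \<comment> \<open>For \<open>d\<close> different from \<open>b\<close>, the flags \<open>d\<close>
    and \<open>\<not> b\<close> agree. Both composed series in \<open>F_evolution\<close> are then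
    the same, and only its product with the \<open>z\<close>-derivative remains.\<close>
  have 1: "has_t_deriv F\<mu> ((B \<circ>\<^sub>z F\<nu> t) * z_deriv (F\<mu> t)) t"
    using F_evolution[of True False t] by (simp add: F BC algebra_simps)
  have 2: "has_t_deriv F\<nu> ((C \<circ>\<^sub>z F\<mu> t) * z_deriv (F\<nu> t)) t"
    using F_evolution[of False True t] by (simp add: F BC algebra_simps)
  have 3: "has_t_deriv F\<mu> ((B \<circ>\<^sub>z F\<mu> t) + (C \<circ>\<^sub>z F\<mu> t) * (z_deriv (F\<mu> t) - 1)) t"
    using F_evolution[of True True t] by (simp add: F BC)
  have 4: "has_t_deriv F\<nu> ((C \<circ>\<^sub>z F\<nu> t) + (B \<circ>\<^sub>z F\<nu> t) * (z_deriv (F\<nu> t) - 1)) t"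
    using F_evolution[of False False t] by (simp add: F BC)
  have 5: "has_t_deriv F\<mu> ((B \<circ>\<^sub>z F\<nu> t) * ((B \<circ>\<^sub>z F\<mu> t) - (C \<circ>\<^sub>z F\<mu> t)) /
      ((B \<circ>\<^sub>z F\<nu> t) - (C \<circ>\<^sub>z F\<mu> t))) t"
    if "(B \<circ>\<^sub>z F\<nu> t) - (C \<circ>\<^sub>z F\<mu> t) \<noteq> 0"
    using evolution_quotient[OF refl has_t_deriv_unique[OF 1 3] that] 1 by simp
  have ne: "(C \<circ>\<^sub>z F\<mu> t) - (B \<circ>\<^sub>z F\<nu> t) \<noteq> 0" if "(B \<circ>\<^sub>z F\<nu> t) - (C \<circ>\<^sub>z F\<mu> t) \<noteq> 0"
    using that by auto
  \<comment> \<open>Elimination for \<open>F\<nu>\<close> yields the negative of the required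
    denominator, so the signs of numerator and denominator are both changed.\<close>
  have "p * (q - r) / (p - r) = p * (r - q) / (r - p)" for p q r :: "complex fls"
  proof -
    have "p * (q - r) / (p - r) = - (p * (q - r)) / - (p - r)"
      by (rule minus_divide_divide[symmetric])
    then show ?thesis by (simp only: minus_diff_eq mult_minus_right[symmetric])
  qed
  with evolution_quotient[OF refl has_t_deriv_unique[OF 2 4] ne] 2
  have 6: "has_t_deriv F\<nu> ((C \<circ>\<^sub>z F\<mu> t) * ((B \<circ>\<^sub>z F\<nu> t) - (C \<circ>\<^sub>z F\<nu> t)) /
      ((B \<circ>\<^sub>z F\<nu> t) - (C \<circ>\<^sub>z F\<mu> t))) t"
    if "(B \<circ>\<^sub>z F\<nu> t) - (C \<circ>\<^sub>z F\<mu> t) \<noteq> 0"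
    using that by simp
  from 1 2 3 4 5 6 show ?thesis by blast
qed

end
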